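(* (a) Let $G$ be a line graph and let $t\leq 4$ be a positive integer. Then $G$ has a $K_t$-immersion if and only if $G$ has a $K_t$-minor. (b) For every integer $t\geq 5$ there exists a line graph that has a $K_t$-immersion but no $K_t$-minor, and there exists a line graph that has a $K_t$-minor but no $K_t$-immersion.
   Context: Graphs are finite and may have parallel edges but no loops. A line graph is a graph of the form $L(H)$ for some graph $H$ (possibly with parallel edges), where $L(H)$ is the simple graph with vertex set $E(H)$ in which two distinct edges of $H$ are adjacent iff they share at least one endpoint. A graph $G$ has a $K_t$-immersion if there is an injective map $\phi$ from the vertex set of $K_t$ to $V(G)$ and, for each pair $u\neq v$ of vertices of $K_t$, a path in $G$ joining $\phi(u)$ and $\phi(v)$, such that these paths are pairwise edge-disjoint. $G$ has a $K_t$-minor if $K_t$ can be obtained from a subgraph of $G$ by contracting edges. *)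

theory Defs
  imports Main
begin

type_synonym 'a graph = "'a set \<times> 'a set set"

definition verts :: "'a graph \<Rightarrow> 'a set" where "verts G = fst G"
definition edges :: "'a graph \<Rightarrow> 'a set set" where "edges G = snd G"

definition simple_graph :: "'a graph \<Rightarrow> bool" where
  "simple_graph G \<longleftrightarrow> finite (verts G) \<and>
     (\<forall>e\<in>edges G. card e = 2 \<and> e \<subseteq> verts G)"

text \<open>Line graphs. G is (isomorphic to) L(H) for a loopless multigraph H, whose
  edges are identified with the vertices of G: each vertex v of G is an edge of H
  with endpoint set ends v (two distinct vertices of H; the vertex type of H is nat,
  which is no restriction for finite H). Parallel edges of H are allowed since
  distinct v may have the same ends.\<close>
definition line_graph :: "'a graph \<Rightarrow> bool" where
  "line_graph G \<longleftrightarrow> (\<exists>ends :: 'a \<Rightarrow> nat set.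
      (\<forall>v\<in>verts G. card (ends v) = 2) \<and>
      (\<forall>u\<in>verts G. \<forall>v\<in>verts G. u \<noteq> v \<longrightarrow>
          ({u, v} \<in> edges G \<longleftrightarrow> ends u \<inter> ends v \<noteq> {})))"

definition is_path :: "'a graph \<Rightarrow> 'a list \<Rightarrow> 'a \<Rightarrow> 'a \<Rightarrow> bool" where
  "is_path G p x y \<longleftrightarrow> p \<noteq> [] \<and> hd p = x \<and> last p = y \<and> distinct p \<and>
     set p \<subseteq> verts G \<and> (\<forall>i. Suc i < length p \<longrightarrow> {p ! i, p ! Suc i} \<in> edges G)"

definition path_edges :: "'a list \<Rightarrow> 'a set set" where
  "path_edges p = {{p ! i, p ! Suc i} | i. Suc i < length p}"

definition has_K_immersion :: "'a graph \<Rightarrow> nat \<Rightarrow> bool" where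
  "has_K_immersion G t \<longleftrightarrow> (\<exists>(\<phi> :: nat \<Rightarrow> 'a) (P :: nat \<Rightarrow> nat \<Rightarrow> 'a list).
     inj_on \<phi> {..<t} \<and> \<phi> ` {..<t} \<subseteq> verts G \<and>
     (\<forall>i<t. \<forall>j<t. i < j \<longrightarrow> is_path G (P i j) (\<phi> i) (\<phi> j)) \<and>
     (\<forall>i<t. \<forall>j<t. \<forall>k<t. \<forall>l<t. i < j \<and> k < l \<and> (i, j) \<noteq> (k, l) \<longrightarrow>
        path_edges (P i j) \<inter> path_edges (P k l) = {}))"

definition subgraph :: "'a graph \<Rightarrow> 'a graph \<Rightarrow> bool" where
  "subgraph H G \<longleftrightarrow> verts H \<subseteq> verts G \<and> edges H \<subseteq> edges G \<and>
     (\<forall>e\<in>edges H. e \<subseteq> verts H)"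

definition contract :: "'a graph \<Rightarrow> 'a \<Rightarrow> 'a \<Rightarrow> 'a graph" where
  "contract G u v = (verts G - {v},
     {e \<in> edges G. v \<notin> e} \<union> {{u, w} | w. {v, w} \<in> edges G \<and> w \<noteq> u})"

inductive contracts_to :: "'a graph \<Rightarrow> 'a graph \<Rightarrow> bool" where
  refl: "contracts_to G G"
| step: "contracts_to G H \<Longrightarrow> {u, v} \<in> edges H \<Longrightarrow> u \<noteq> v \<Longrightarrow>
           contracts_to G (contract H u v)"

definition complete_graph :: "'a graph \<Rightarrow> nat \<Rightarrow> bool" where
  "complete_graph H t \<longleftrightarrow> card (verts H) = t \<and> finite (verts H) \<and>
     (\<forall>u\<in>verts H. \<forall>v\<in>verts H. u \<noteq> v \<longrightarrow> {u, v} \<in> edges H)"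

definition has_K_minor :: "'a graph \<Rightarrow> nat \<Rightarrow> bool" where
  "has_K_minor G t \<longleftrightarrow> (\<exists>S H. subgraph S G \<and> contracts_to S H \<and> complete_graph H t)"

end

theory Submission
  imports Defs
begin

text \<open>
  A \<open>K\<^sub>t\<close>-minor is a family of \<open>t\<close> disjoint connected branch sets with an edge between any two.
  For \<open>t \<le> 4\<close> each branch set has at most three attachments, which are joined by an edge-disjoint
  tripod, so a minor gives an immersion. Conversely, let a line graph \<open>L(H)\<close> have a
  \<open>K\<^sub>4\<close>-immersion. If some vertex of \<open>H\<close> has four edges, they form a \<open>K\<^sub>4\<close>.
  Otherwise \<open>L(H)\<close> has maximum degree at most 4, so no path of the immersion
  passes through a branch vertex and at most two pass through any other vertex. Such a system of
  six paths can be contracted, keeping these two properties, until its union has minimum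
  degree 3, and every graph of minimum degree 3 has a \<open>K\<^sub>4\<close>-minor.

  For \<open>t \<ge> 5\<close>, let \<open>H\<close> be \<open>K\<^sub>4\<close> with one edge replaced by \<open>t - 4\<close> parallel ones: the
  edge opposite to the thick one serves to route the two missing adjacencies among
  the \<open>t\<close> others, but three disjoint non-edges on \<open>t + 1\<close> vertices exclude a \<open>K\<^sub>t\<close>-minor.
  For the other direction, let \<open>H\<close> be a fan with \<open>t - 1\<close> spokes and subdivided rim: contracting the rim in
  \<open>L(H)\<close> gives \<open>K\<^sub>t\<close>, but only the spokes have degree at least 4.
\<close>

section \<open>Paths and connected sets\<close>

lemma path_edges_Nil [simp]: "path_edges [] = {}"
  by (simp add: path_edges_def)

lemma path_edges_single [simp]: "path_edges [x] = {}"
  by (simp add: path_edges_def)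

lemma path_edges_Cons2 [simp]:
  "path_edges (x # y # p) = insert {x, y} (path_edges (y # p))"
proof -
  have "e \<in> path_edges (x # y # p)" if e: "e \<in> insert {x, y} (path_edges (y # p))" for e
  proof (cases "e = {x, y}")
    case True
    then show ?thesis by (force simp: path_edges_def intro: exI[of _ 0])
  next
    case False
    then obtain i where "e = {(y # p) ! i, (y # p) ! Suc i}" "Suc i < length (y # p)"
      using e by (auto simp: path_edges_def)
    then show ?thesis unfolding path_edges_def
      by (intro CollectI exI[of _ "Suc i"]) simp
  qed
  moreover have "e \<in> insert {x, y} (path_edges (y # p))" if e: "e \<in> path_edges (x # y # p)" for e
  proof -
    obtain i where i: "e = {(x # y # p) ! i, (x # y # p) ! Suc i}" "Suc i < length (x # y # p)"
      using e by (auto simp: path_edges_def)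
    show ?thesis
      using i by (cases i) (auto simp: path_edges_def)
  qed
  ultimately show ?thesis by blast
qed

lemma path_edges_append:
  "path_edges (p @ q) = path_edges p \<union> path_edges q \<union>
     (if p = [] \<or> q = [] then {} else {{last p, hd q}})"
proof (induction p rule: induct_list012)
  case (2 x)
  then show ?case by (cases q) auto
qed auto

lemma path_edges_rev [simp]: "path_edges (rev p) = path_edges p"
  by (induction p rule: induct_list012) (auto simp: path_edges_append last_rev insert_commute)

lemma path_edges_subset_iff:
  "path_edges p \<subseteq> E \<longleftrightarrow> (\<forall>i. Suc i < length p \<longrightarrow> {p ! i, p ! Suc i} \<in> E)"
  by (auto simp: path_edges_def)

lemma is_path_iff:
  "is_path G p x y \<longleftrightarrow> p \<noteq> [] \<and> hd p = x \<and> last p = y \<and> distinct p \<and>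
     set p \<subseteq> verts G \<and> path_edges p \<subseteq> edges G"
  by (auto simp: is_path_def path_edges_subset_iff)

lemma path_edges_subset_set: "e \<in> path_edges p \<Longrightarrow> e \<subseteq> set p"
  by (auto simp: path_edges_def)

lemma path_edges_card: "distinct p \<Longrightarrow> e \<in> path_edges p \<Longrightarrow> card e = 2"
  by (auto simp: path_edges_def nth_eq_iff_index_eq)

text \<open>An edge of a path without repetition has two elements, so it does not fit into a single
  common vertex.\<close>

lemma path_edges_disjoint:
  assumes "distinct p" and "set p \<inter> set q \<subseteq> {m}"
  shows "path_edges p \<inter> path_edges q = {}"
proof -
  have False if "e \<in> path_edges p" "e \<in> path_edges q" for e
  proof -
    have "e \<subseteq> {m}"
      using that[THEN path_edges_subset_set] assms(2) by blast
    then have "card e \<le> card {m}" by (intro card_mono) auto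
    then show False using path_edges_card[OF assms(1) that(1)] by simp
  qed
  then show ?thesis by blast
qed

section \<open>Connected vertex sets\<close>

definition adj_in :: "'a set set \<Rightarrow> 'a set \<Rightarrow> ('a \<times> 'a) set" where
  "adj_in E S = {(x, y). x \<in> S \<and> y \<in> S \<and> {x, y} \<in> E}"

text \<open>Nonemptiness is included so that branch sets are nonempty; \<open>adj_in\<close>
  confines the connecting walks to \<open>S\<close>.\<close>

definition connected_in :: "'a set set \<Rightarrow> 'a set \<Rightarrow> bool" where
  "connected_in E S \<longleftrightarrow> S \<noteq> {} \<and> (\<forall>x\<in>S. \<forall>y\<in>S. (x, y) \<in> (adj_in E S)\<^sup>*)"

lemma sym_adj_in: "sym (adj_in E S)"
  by (auto simp: sym_def adj_in_def insert_commute)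

lemma connected_inI:
  assumes "r \<in> S" and "\<And>x. x \<in> S \<Longrightarrow> (r, x) \<in> (adj_in E S)\<^sup>*"
  shows "connected_in E S"
  unfolding connected_in_def
  using assms sym_rtrancl[OF sym_adj_in, of E S]
  by (meson empty_iff rtrancl_trans symD)

lemma connected_in_singleton [simp]: "connected_in E {x}"
  by (rule connected_inI) auto

text \<open>\<open>f\<close> may collapse an edge to a point, as a contraction does. With the
  identity for \<open>f\<close>, connectedness is moved to another edge set.\<close>

lemma connected_in_image:
  assumes con: "connected_in E S"
    and step: "\<And>x y. x \<in> S \<Longrightarrow> y \<in> S \<Longrightarrow> {x, y} \<in> E \<Longrightarrow> f x = f y \<or> {f x, f y} \<in> E'"
  shows "connected_in E' (f ` S)"
proof -
  obtain r where r: "r \<in> S" using con by (auto simp: connected_in_def)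
  have "(f r, f x) \<in> (adj_in E' (f ` S))\<^sup>*" if "(r, x) \<in> (adj_in E S)\<^sup>*" for x
    using that
  proof (induction rule: rtrancl_induct)
    case (step y z)
    then have "f y = f z \<or> (f y, f z) \<in> adj_in E' (f ` S)"
      using assms(2)[of y z] by (auto simp: adj_in_def)
    then show ?case using step.IH by (auto intro: rtrancl_into_rtrancl)
  qed simp
  then show ?thesis
    using con r by (intro connected_inI[of "f r"]) (auto simp: connected_in_def)
qed

lemma connected_in_segment:
  assumes "path_edges p \<subseteq> E" and "a < b" and "b \<le> length p"
  shows "connected_in E ((!) p ` {a..<b})"
proof (rule connected_inI)
  show "p ! a \<in> (!) p ` {a..<b}" using assms by auto
  have "(p ! a, p ! k) \<in> (adj_in E ((!) p ` {a..<b}))\<^sup>*" if "a \<le> k" "k < b" for k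
    using that
  proof (induction k rule: dec_induct)
    case (step k)
    then have "(p ! k, p ! Suc k) \<in> adj_in E ((!) p ` {a..<b})"
      using assms by (auto simp: adj_in_def path_edges_subset_iff)
    with step show ?case by (auto intro: rtrancl_into_rtrancl)
  qed simp
  then show "(p ! a, x) \<in> (adj_in E ((!) p ` {a..<b}))\<^sup>*" if "x \<in> (!) p ` {a..<b}" for x
    using that by auto
qed

lemma connected_in_obtain_path:
  assumes "connected_in E S" and "x \<in> S" and "y \<in> S"
  obtains p where "p \<noteq> []" "hd p = x" "last p = y" "distinct p" "set p \<subseteq> S" "path_edges p \<subseteq> E"
proof -
  have "(x, y) \<in> (adj_in E S)\<^sup>*" using assms by (auto simp: connected_in_def)
  then have "\<exists>p. p \<noteq> [] \<and> hd p = x \<and> last p = y \<and> distinct p \<and> set p \<subseteq> S \<and> path_edges p \<subseteq> E"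
  proof (induction rule: converse_rtrancl_induct)
    case base
    show ?case using assms(3) by (intro exI[of _ "[y]"]) auto
  next
    case (step x z)
    then obtain p where p: "p \<noteq> []" "hd p = z" "last p = y" "distinct p" "set p \<subseteq> S" "path_edges p \<subseteq> E"
      by blast
    show ?case
    proof (cases "x \<in> set p")
      case True
      \<comment> \<open>The new start already lies on the path, so the closed walk in front of its
        occurrence is cut off.\<close>
      then obtain p1 p2 where "p = p1 @ x # p2" using split_list by fast
      then show ?thesis
        using p by (intro exI[of _ "x # p2"]) (auto simp: path_edges_append)
    next
      case False
      then show ?thesis
        using p step(1) by (intro exI[of _ "x # p"]) (cases p; auto simp: adj_in_def)
    qed
  qed
  then show ?thesis using that by blast
qed

section \<open>Branch sets and minors\<close>

text \<open>Branch-set form of a minor, shown below to be equivalent to the contraction form.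
  Vertices outside all branch sets are allowed.\<close>

definition K_model :: "'a graph \<Rightarrow> nat \<Rightarrow> (nat \<Rightarrow> 'a set) \<Rightarrow> bool" where
  "K_model G t B \<longleftrightarrow> (\<forall>i<t. B i \<subseteq> verts G \<and> connected_in (edges G) (B i)) \<and>
     (\<forall>i<t. \<forall>j<t. i \<noteq> j \<longrightarrow> B i \<inter> B j = {} \<and> (\<exists>x\<in>B i. \<exists>y\<in>B j. {x, y} \<in> edges G))"

lemma K_modelI:
  assumes "\<And>i. i < t \<Longrightarrow> B i \<subseteq> verts G" and "\<And>i. i < t \<Longrightarrow> connected_in (edges G) (B i)"
    and "\<And>i j. i < j \<Longrightarrow> j < t \<Longrightarrow> B i \<inter> B j = {}"
    and "\<And>i j. i < j \<Longrightarrow> j < t \<Longrightarrow> \<exists>x\<in>B i. \<exists>y\<in>B j. {x, y} \<in> edges G"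
  shows "K_model G t B"
  unfolding K_model_def
proof (intro conjI allI impI)
  fix i j assume "i < t" "j < t" "i \<noteq> j"
  then consider "i < j" | "j < i" by linarith
  then show "B i \<inter> B j = {}" "\<exists>x\<in>B i. \<exists>y\<in>B j. {x, y} \<in> edges G"
    by (cases; use assms(3,4)[of i j] assms(3,4)[of j i] \<open>i < t\<close> \<open>j < t\<close> in
      \<open>fastforce simp: insert_commute\<close>)+
qed (use assms in auto)

lemma K_model_obtain_edge:
  assumes "K_model G t B" and "i < t" and "j < t" and "i \<noteq> j"
  obtains x y where "x \<in> B i" "y \<in> B j" "{x, y} \<in> edges G"
  using assms unfolding K_model_def by blast

lemma K_model_singletons:
  assumes "\<And>i. i < t \<Longrightarrow> b i \<in> verts G"
    and "\<And>i j. i < j \<Longrightarrow> j < t \<Longrightarrow> b i \<noteq> b j"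
    and "\<And>i j. i < j \<Longrightarrow> j < t \<Longrightarrow> {b i, b j} \<in> edges G"
  shows "K_model G t (\<lambda>i. {b i})"
  by (rule K_modelI) (use assms in auto)

lemma K_model_mono:
  assumes "K_model G t B" and "verts G \<subseteq> verts G'" and "edges G \<subseteq> edges G'"
  shows "K_model G' t B"
proof -
  have "connected_in (edges G') (B i)" if "i < t" for i
    using connected_in_image[of "edges G" "B i" "\<lambda>x. x" "edges G'"] assms that
    by (auto simp: K_model_def)
  then show ?thesis using assms unfolding K_model_def by (meson subset_iff)
qed

text \<open>\<open>w\<close> joins the branch set that contains \<open>u\<close>, so that every edge
  moved from \<open>w\<close> to \<open>u\<close> can be traced through \<open>w\<close> again.
  \<open>E\<close> is weaker than an equation with \<open>contract\<close>, so that the lemma also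
  serves the shortening of path systems.\<close>

lemma K_model_uncontract:
  assumes model: "K_model G' t B"
    and V: "verts G' \<subseteq> verts G" "w \<in> verts G" "w \<notin> verts G'"
    and uw: "{u, w} \<in> edges G"
    and E: "\<And>a b. {a, b} \<in> edges G' \<Longrightarrow>
      {a, b} \<in> edges G \<or> a = u \<and> {w, b} \<in> edges G \<or> b = u \<and> {w, a} \<in> edges G"
  shows "K_model G t (\<lambda>i. if u \<in> B i then insert w (B i) else B i)"
    (is "K_model G t ?B")
proof (rule K_modelI)
  fix i assume i: "i < t"
  then show "?B i \<subseteq> verts G" using model V by (auto simp: K_model_def)
  have con: "connected_in (edges G') (B i)" and sub: "B i \<subseteq> verts G'"
    using model i by (auto simp: K_model_def)
  show "connected_in (edges G) (?B i)"
  proof (cases "u \<in> B i")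
    case False
    \<comment> \<open>Without \<open>u\<close> in the branch set, \<open>E\<close> leaves only
      genuine edges of \<open>G\<close> inside it.\<close>
    then have "connected_in (edges G) ((\<lambda>x. x) ` B i)"
      using con by (rule_tac connected_in_image) (use E in blast)+
    with False show ?thesis by simp
  next
    case True
    have "(u, x) \<in> (adj_in (edges G) (?B i))\<^sup>*" if "(u, x) \<in> (adj_in (edges G') (B i))\<^sup>*" for x
      using that
    proof (induction rule: rtrancl_induct)
      case (step y z)
      have yz: "y \<in> B i" "z \<in> B i" "{y, z} \<in> edges G'" using step(2) by (auto simp: adj_in_def)
      \<comment> \<open>An edge of \<open>G'\<close> is kept or becomes a detour of two edges
        through \<open>w\<close>.\<close>
      have "(y, z) \<in> (adj_in (edges G) (?B i))\<^sup>*"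
        using E[OF yz(3)]
      proof (elim disjE conjE)
        assume "{y, z} \<in> edges G"
        then show ?thesis using yz True by (auto simp: adj_in_def)
      next
        assume "y = u" "{w, z} \<in> edges G"
        then have "(y, w) \<in> adj_in (edges G) (?B i)" "(w, z) \<in> adj_in (edges G) (?B i)"
          using yz True uw by (auto simp: adj_in_def)
        then show ?thesis by simp
      next
        assume "z = u" "{w, y} \<in> edges G"
        then have "(y, w) \<in> adj_in (edges G) (?B i)" "(w, z) \<in> adj_in (edges G) (?B i)"
          using yz True uw by (auto simp: adj_in_def insert_commute)
        then show ?thesis by simp
      qed
      with step.IH show ?case by (rule rtrancl_trans)
    qed simp
    moreover have "(u, w) \<in> adj_in (edges G) (?B i)"
      using True uw by (auto simp: adj_in_def)
    ultimately show ?thesis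
      using True con by (intro connected_inI[of u]) (auto simp: connected_in_def)
  qed
next
  fix i j assume ij: "i < j" "j < t"
  then have dis: "B i \<inter> B j = {}" and sub: "B i \<subseteq> verts G'" "B j \<subseteq> verts G'"
    using model by (auto simp: K_model_def)
  then show "?B i \<inter> ?B j = {}" using V by auto
  obtain x y where xy: "x \<in> B i" "y \<in> B j" "{x, y} \<in> edges G'"
    using K_model_obtain_edge[OF model, of i j] ij by auto
  from E[OF xy(3)] show "\<exists>x\<in>?B i. \<exists>y\<in>?B j. {x, y} \<in> edges G"
  proof (elim disjE conjE)
    assume "{x, y} \<in> edges G"
    then show ?thesis using xy by auto
  next
    assume "x = u" "{w, y} \<in> edges G"
    then show ?thesis using xy by (intro bexI[of _ w] bexI[of _ y]) auto
  next
    assume "y = u" "{w, x} \<in> edges G"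
    then show ?thesis using xy by (intro bexI[of _ x] bexI[of _ w]) (auto simp: insert_commute)
  qed
qed

section \<open>Contraction sequences and branch sets\<close>

lemma simple_graph_contract:
  assumes G: "simple_graph G" and uv: "{u, v} \<in> edges G" "u \<noteq> v"
  shows "simple_graph (contract G u v)"
proof -
  have "card {u, w} = 2 \<and> {u, w} \<subseteq> verts G - {v}" if "{v, w} \<in> edges G" "w \<noteq> u" for w
  proof -
    have "card {v, w} = 2" "{v, w} \<subseteq> verts G" "{u, v} \<subseteq> verts G"
      using G that uv unfolding simple_graph_def by blast+
    then show ?thesis using that uv by (cases "v = w") auto
  qed
  then show ?thesis using G
    by (auto simp: simple_graph_def contract_def verts_def edges_def)
qed

text \<open>The contractions are undone one at a time from the last, so \<open>B\<close> varies in
  the induction. Simplicity is carried along because it places the ends of the contracted edge among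
  the vertices.\<close>

lemma contracts_to_K_model:
  assumes "contracts_to S H" and "simple_graph S"
  shows "simple_graph H \<and> (K_model H t B \<longrightarrow> (\<exists>B. K_model S t B))"
  using assms
proof (induction arbitrary: B rule: contracts_to.induct)
  case (step S H u v)
  then have H: "simple_graph H" by blast
  then have v: "v \<in> verts H" using step by (auto simp: simple_graph_def)
  have "\<exists>B. K_model S t B" if "K_model (contract H u v) t B"
  proof -
    have "{a, b} \<in> edges H \<or> a = u \<and> {v, b} \<in> edges H \<or> b = u \<and> {v, a} \<in> edges H"
      if "{a, b} \<in> edges (contract H u v)" for a b
      using that by (auto simp: contract_def edges_def doubleton_eq_iff)
    then have "K_model H t (\<lambda>i. if u \<in> B i then insert v (B i) else B i)"
      using that step v
      by (intro K_model_uncontract[where G' = "contract H u v"])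
        (auto simp: contract_def verts_def)
    then show ?thesis using step by blast
  qed
  then show ?case using simple_graph_contract[OF H] step by blast
qed auto

text \<open>As long as some branch set has two vertices, an edge inside it is contracted. The branch
  sets cover \<open>H\<close>, so once all are singletons \<open>H\<close> has exactly
  \<open>t\<close> vertices, any two of them adjacent. \<open>S\<close> records where the
  contraction sequence started.\<close>

lemma K_model_contracts_to_complete:
  assumes "K_model H t B" and "verts H = (\<Union>i<t. B i)" and "simple_graph H"
    and "contracts_to S H"
  shows "\<exists>H'. contracts_to S H' \<and> complete_graph H' t"
  using assms
proof (induction "card (verts H)" arbitrary: H B rule: less_induct)
  case less
  have fin: "finite (verts H)" using less.prems by (auto simp: simple_graph_def)
  show ?case
  proof (cases "\<forall>i<t. \<forall>x\<in>B i. \<forall>y\<in>B i. x = y")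
    case True
    have "\<forall>i<t. \<exists>x. B i = {x}"
      using True less.prems(1) by (auto simp: K_model_def connected_in_def) blast
    then obtain b where b: "\<And>i. i < t \<Longrightarrow> B i = {b i}" by metis
    have V: "verts H = b ` {..<t}" using b less.prems(2) by auto
    have "inj_on b {..<t}"
      using less.prems(1) b by (fastforce simp: inj_on_def K_model_def)
    moreover have "{b i, b j} \<in> edges H" if "i < t" "j < t" "b i \<noteq> b j" for i j
      using less.prems(1) that b[of i] b[of j] unfolding K_model_def by fastforce
    ultimately have "complete_graph H t"
      using V by (auto simp: complete_graph_def card_image)
    then show ?thesis using less.prems by blast
  next
    case False
    then obtain i x y where i: "i < t" "x \<in> B i" "y \<in> B i" "x \<noteq> y" by blast
    then have "(x, y) \<in> (adj_in (edges H) (B i))\<^sup>*"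
      using less.prems(1) by (auto simp: K_model_def connected_in_def)
    \<comment> \<open>The first step of a walk from \<open>x\<close> to \<open>y\<close> inside the
      branch set gives the edge to contract.\<close>
    then obtain z where "(x, z) \<in> adj_in (edges H) (B i)"
      using i by (metis converse_rtranclE)
    then have z: "z \<in> B i" "{x, z} \<in> edges H" by (auto simp: adj_in_def)
    then have "x \<noteq> z" using less.prems(3) by (auto simp: simple_graph_def)
    \<comment> \<open>The contraction map: \<open>z\<close> is merged into \<open>x\<close>, all
      else is fixed.\<close>
    let ?f = "\<lambda>a. if a = z then x else a"
    have E: "?f a = ?f b \<or> {?f a, ?f b} \<in> edges (contract H x z)" if "{a, b} \<in> edges H" for a b
      using that by (auto simp: contract_def edges_def insert_commute)
    have dis: "B j \<inter> B k = {}" if "j < t" "k < t" "j \<noteq> k" for j k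
      using less.prems(1) that by (auto simp: K_model_def)
    have notin: "x \<notin> B j" "z \<notin> B j" if "j < t" "j \<noteq> i" for j
      using dis[of i j] i z that by auto
    have same: "?f ` B j = B j" if "j < t" "j \<noteq> i" for j
      using notin[OF that] by force
    have at_i: "?f ` B i = B i - {z}"
      using i z \<open>x \<noteq> z\<close> by auto
    have "K_model (contract H x z) t (\<lambda>j. ?f ` B j)"
    proof (rule K_modelI)
      fix j assume j: "j < t"
      show "?f ` B j \<subseteq> verts (contract H x z)"
        using less.prems(1) j \<open>x \<noteq> z\<close> i
        by (auto simp: contract_def K_model_def verts_def)
      show "connected_in (edges (contract H x z)) (?f ` B j)"
        using less.prems(1) j E by (intro connected_in_image[of "edges H"]) (auto simp: K_model_def)
    next
      fix j k assume jk: "j < k" "k < t"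
      show d: "?f ` B j \<inter> ?f ` B k = {}"
        using dis[of j k] jk at_i same[of j] same[of k] by (cases "j = i"; cases "k = i") auto
      obtain a b where ab: "a \<in> B j" "b \<in> B k" "{a, b} \<in> edges H"
        using K_model_obtain_edge[OF less.prems(1), of j k] jk by auto
      have "?f a \<noteq> ?f b" using d ab by blast
      then show "\<exists>a\<in>?f ` B j. \<exists>b\<in>?f ` B k. {a, b} \<in> edges (contract H x z)"
        using E[OF ab(3)] ab by blast
    qed
    moreover have "verts (contract H x z) = (\<Union>j<t. ?f ` B j)"
    proof -
      have "(\<Union>j<t. ?f ` B j) = ?f ` (\<Union>j<t. B j)" by blast
      also have "\<dots> = ?f ` verts H" using less.prems(2) by simp
      also have "\<dots> = verts H - {z}"
        using i z \<open>x \<noteq> z\<close> less.prems(2) by auto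
      finally show ?thesis by (simp add: contract_def verts_def)
    qed
    moreover have "card (verts (contract H x z)) < card (verts H)"
      using fin z i less.prems(2) by (auto simp: contract_def verts_def intro!: psubset_card_mono)
    ultimately show ?thesis
      using less.hyps simple_graph_contract[OF less.prems(3) z(2) \<open>x \<noteq> z\<close>]
        contracts_to.step[OF less.prems(4) z(2) \<open>x \<noteq> z\<close>] by blast
  qed
qed

lemma has_K_minor_iff_K_model:
  assumes G: "simple_graph G"
  shows "has_K_minor G t \<longleftrightarrow> (\<exists>B. K_model G t B)"
proof
  assume "has_K_minor G t"
  then obtain S H where S: "subgraph S G" "contracts_to S H" "complete_graph H t"
    by (auto simp: has_K_minor_def)
  have simple: "simple_graph S"
    using S(1) G by (auto simp: subgraph_def simple_graph_def intro: finite_subset)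
  obtain b where b: "bij_betw b {..<t} (verts H)"
    using S(3) ex_bij_betw_nat_finite[of "verts H"]
    by (auto simp: complete_graph_def atLeast0LessThan)
  have "K_model H t (\<lambda>i. {b i})"
  proof (rule K_model_singletons)
    show b_in: "b i \<in> verts H" if "i < t" for i
      using b that by (auto simp: bij_betw_def)
    fix i j assume ij: "i < j" "j < t"
    then show "b i \<noteq> b j" using b by (auto simp: bij_betw_def inj_on_def)
    then show "{b i, b j} \<in> edges H"
      using S(3) b_in[of i] b_in[of j] ij by (auto simp: complete_graph_def)
  qed
  then obtain B where "K_model S t B"
    using contracts_to_K_model[OF S(2) simple] by blast
  then show "\<exists>B. K_model G t B"
    using K_model_mono[of S t B G] S(1) unfolding subgraph_def by blast
next
  assume "\<exists>B. K_model G t B"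
  then obtain B where B: "K_model G t B" by blast
  \<comment> \<open>Restricting to the union of the branch sets keeps stray vertices out of the
    contracted graph, which must have exactly \<open>t\<close> vertices.\<close>
  define W where "W = (\<Union>i<t. B i)"
  define S where "S = (W, {e \<in> edges G. e \<subseteq> W})"
  have S: "verts S = W" "edges S = {e \<in> edges G. e \<subseteq> W}"
    by (auto simp: S_def verts_def edges_def)
  have W: "W \<subseteq> verts G" using B by (auto simp: W_def K_model_def)
  have "K_model S t B"
  proof (rule K_modelI)
    fix i assume i: "i < t"
    then show "B i \<subseteq> verts S" unfolding S W_def by blast
    show "connected_in (edges S) (B i)"
      using connected_in_image[of "edges G" "B i" "\<lambda>x. x" "edges S"] B i
      by (auto simp: S W_def K_model_def)
  next
    fix i j assume ij: "i < j" "j < t"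
    then show "B i \<inter> B j = {}" using B by (auto simp: K_model_def)
    obtain x y where "x \<in> B i" "y \<in> B j" "{x, y} \<in> edges G"
      using K_model_obtain_edge[OF B, of i j] ij by auto
    moreover have "B i \<subseteq> W" "B j \<subseteq> W" unfolding W_def using ij by (auto intro!: UN_upper)
    ultimately show "\<exists>x\<in>B i. \<exists>y\<in>B j. {x, y} \<in> edges S"
      unfolding S by blast
  qed
  moreover have "simple_graph S"
    using G W by (auto simp: simple_graph_def S intro: finite_subset)
  ultimately have "\<exists>H. contracts_to S H \<and> complete_graph H t"
    using K_model_contracts_to_complete[OF _ _ _ contracts_to.refl, of S t B] by (simp add: S W_def)
  moreover have "subgraph S G" using W by (auto simp: subgraph_def S)
  ultimately show "has_K_minor G t" unfolding has_K_minor_def by blast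
qed

section \<open>Immersions from minors\<close>

text \<open>The centre is the first vertex of a path from \<open>c\<close> to \<open>a\<close> that
  lies on a path from \<open>a\<close> to \<open>b\<close>. The three legs then meet pairwise only
  in \<open>m\<close>, hence share no edge.\<close>

lemma tripod:
  assumes con: "connected_in E S" and abc: "a \<in> S" "b \<in> S" "c \<in> S"
  obtains m p q r where "m \<in> S"
    "p \<noteq> []" "hd p = m" "last p = a" "distinct p" "set p \<subseteq> S" "path_edges p \<subseteq> E"
    "q \<noteq> []" "hd q = m" "last q = b" "distinct q" "set q \<subseteq> S" "path_edges q \<subseteq> E"
    "r \<noteq> []" "hd r = m" "last r = c" "distinct r" "set r \<subseteq> S" "path_edges r \<subseteq> E"
    "path_edges p \<inter> path_edges q = {}" "path_edges p \<inter> path_edges r = {}"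
    "path_edges q \<inter> path_edges r = {}"
proof -
  obtain p where p: "p \<noteq> []" "hd p = a" "last p = b" "distinct p" "set p \<subseteq> S" "path_edges p \<subseteq> E"
    using connected_in_obtain_path[OF con abc(1,2)] .
  obtain q where q: "q \<noteq> []" "hd q = c" "last q = a" "distinct q" "set q \<subseteq> S" "path_edges q \<subseteq> E"
    using connected_in_obtain_path[OF con abc(3,1)] .
  have "a \<in> set p" "a \<in> set q" using p q hd_in_set last_in_set by metis+
  then have "\<exists>x\<in>set q. x \<in> set p" by blast
  then obtain q1 m q2 where q_split: "q = q1 @ m # q2" "m \<in> set p" "\<forall>x\<in>set q1. x \<notin> set p"
    using split_list_first_prop[of q "\<lambda>x. x \<in> set p"] by blast
  obtain p1 p2 where p_split: "p = p1 @ m # p2" using q_split(2) split_list by fast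
  let ?p = "rev (p1 @ [m])" and ?q = "m # p2" and ?r = "rev (q1 @ [m])"
  have d: "distinct ?p" "distinct ?q" "distinct ?r"
    using p(4) q(4) unfolding p_split q_split(1) by auto
  have s: "set ?p \<subseteq> S" "set ?q \<subseteq> S" "set ?r \<subseteq> S"
    using p(5) q(5) unfolding p_split q_split(1) by auto
  have e: "path_edges ?p \<subseteq> E" "path_edges ?q \<subseteq> E" "path_edges ?r \<subseteq> E"
    using p(6) q(6) unfolding path_edges_rev p_split q_split(1)
    by (simp_all add: path_edges_append split: if_splits)
  have h: "hd ?p = m" "last ?p = a" "hd ?q = m" "last ?q = b" "hd ?r = m" "last ?r = c"
    using p(2,3) q(2,3) unfolding p_split q_split(1) by (simp_all add: last_rev hd_append split: if_splits)
  have "set ?p \<inter> set ?q \<subseteq> {m}" using p(4) unfolding p_split by auto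
  moreover have "set ?p \<inter> set ?r \<subseteq> {m}" "set ?q \<inter> set ?r \<subseteq> {m}"
    using q_split(3) unfolding p_split by auto
  ultimately have x: "path_edges ?p \<inter> path_edges ?q = {}" "path_edges ?p \<inter> path_edges ?r = {}"
    "path_edges ?q \<inter> path_edges ?r = {}"
    using path_edges_disjoint d by metis+
  show thesis
    using that[OF _ _ h(1,2) d(1) s(1) e(1) _ h(3,4) d(2) s(2) e(2) _ h(5,6) d(3) s(3) e(3) x]
      q_split(2) p(5) by auto
qed

lemma tripod_indexed:
  fixes x :: "'j \<Rightarrow> 'a"
  assumes con: "connected_in E S" and J: "finite J" "card J \<le> 3" and x: "x ` J \<subseteq> S"
  obtains m Q where "m \<in> S"
    "\<And>j. j \<in> J \<Longrightarrow> Q j \<noteq> [] \<and> hd (Q j) = m \<and> last (Q j) = x j \<and> distinct (Q j) \<and>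
      set (Q j) \<subseteq> S \<and> path_edges (Q j) \<subseteq> E"
    "\<And>j k. j \<in> J \<Longrightarrow> k \<in> J \<Longrightarrow> j \<noteq> k \<Longrightarrow> path_edges (Q j) \<inter> path_edges (Q k) = {}"
proof -
  obtain s where s: "s \<in> S" using con by (auto simp: connected_in_def)
  obtain f where f: "f ` J \<subseteq> {0, 1, 2::nat}" "inj_on f J"
    using card_le_inj[of J "{0, 1, 2::nat}"] J by auto
  \<comment> \<open>Legs that \<open>J\<close> does not ask for get the arbitrary vertex
    \<open>s\<close> of \<open>S\<close> as a default end.\<close>
  define y where "y n = (if n \<in> f ` J then x (inv_into J f n) else s)" for n
  have y: "y n \<in> S" for n using x s by (auto simp: y_def inv_into_into)
  have yf: "y (f j) = x j" if "j \<in> J" for j using that f by (auto simp: y_def)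
  obtain m p q r where mpqr: "m \<in> S"
    "p \<noteq> []" "hd p = m" "last p = y 0" "distinct p" "set p \<subseteq> S" "path_edges p \<subseteq> E"
    "q \<noteq> []" "hd q = m" "last q = y 1" "distinct q" "set q \<subseteq> S" "path_edges q \<subseteq> E"
    "r \<noteq> []" "hd r = m" "last r = y 2" "distinct r" "set r \<subseteq> S" "path_edges r \<subseteq> E"
    "path_edges p \<inter> path_edges q = {}" "path_edges p \<inter> path_edges r = {}"
    "path_edges q \<inter> path_edges r = {}"
    using tripod[OF con y y y] .
  define R where "R n = (if n = 0 then p else if n = 1 then q else r)" for n :: nat
  have R: "R n \<noteq> [] \<and> hd (R n) = m \<and> last (R n) = y n \<and> distinct (R n) \<and>
      set (R n) \<subseteq> S \<and> path_edges (R n) \<subseteq> E" if "n \<in> {0, 1, 2}" for n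
    using mpqr that by (auto simp: R_def)
  have R_dis: "path_edges (R n) \<inter> path_edges (R k) = {}"
    if "n \<in> {0, 1, 2}" "k \<in> {0, 1, 2}" "n \<noteq> k" for n k
    using mpqr(20-) that by (auto simp: R_def)
  show thesis
  proof (rule that[of m "\<lambda>j. R (f j)"])
    fix j assume "j \<in> J"
    then show "R (f j) \<noteq> [] \<and> hd (R (f j)) = m \<and> last (R (f j)) = x j \<and> distinct (R (f j)) \<and>
      set (R (f j)) \<subseteq> S \<and> path_edges (R (f j)) \<subseteq> E"
      using R[of "f j"] f yf by auto
  next
    fix j k assume jk: "j \<in> J" "k \<in> J" "j \<noteq> k"
    then have "f j \<noteq> f k" using f by (auto dest: inj_onD)
    then show "path_edges (R (f j)) \<inter> path_edges (R (f k)) = {}"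
      using jk f by (intro R_dis) auto
  qed fact
qed

text \<open>The centre of the tripod in \<open>B i\<close> becomes the branch vertex
  \<open>m i\<close>. The path to \<open>m j\<close> follows a leg, the chosen edge between
  \<open>B i\<close> and \<open>B j\<close>, and a leg of the other tripod backwards.
  \<open>t \<le> 4\<close> leaves at most three legs in each branch set.\<close>

lemma K_model_imp_immersion:
  assumes G: "simple_graph G" and B: "K_model G t B" and t: "t \<le> 4"
  shows "has_K_immersion G t"
proof -
  define f where "f i j = (SOME xy. fst xy \<in> B i \<and> snd xy \<in> B j \<and> {fst xy, snd xy} \<in> edges G)" for i j
  have f: "fst (f i j) \<in> B i \<and> snd (f i j) \<in> B j \<and> {fst (f i j), snd (f i j)} \<in> edges G"
    if ij: "i < j" "j < t" for i j
  proof -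
    obtain x y where "x \<in> B i" "y \<in> B j" "{x, y} \<in> edges G"
      using K_model_obtain_edge[OF B, of i j] ij by auto
    then have "\<exists>xy. fst xy \<in> B i \<and> snd xy \<in> B j \<and> {fst xy, snd xy} \<in> edges G"
      by (intro exI[of _ "(x, y)"]) simp
    then show ?thesis
      unfolding f_def by (rule someI_ex)
  qed
  \<comment> \<open>\<open>x i j\<close> is the end in \<open>B i\<close> of the edge chosen for the
    unordered pair of \<open>i\<close> and \<open>j\<close>; \<open>f\<close> is meaningful only for
    \<open>i < j\<close>.\<close>
  define x where "x i j = (if i < j then fst (f i j) else snd (f j i))" for i j
  have x_in: "x i j \<in> B i" if "i < t" "j < t" "i \<noteq> j" for i j
  proof (cases "i < j")
    case True
    then show ?thesis using f[OF True] that by (simp add: x_def)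
  next
    case False
    then have "j < i" using that by simp
    then show ?thesis using f[OF \<open>j < i\<close>] that by (simp add: x_def)
  qed
  have x_edge: "{x i j, x j i} \<in> edges G" if "i < j" "j < t" for i j
    using f[OF that] that by (simp add: x_def)
  have con: "connected_in (edges G) (B i)" and sub: "B i \<subseteq> verts G" if "i < t" for i
    using B that by (auto simp: K_model_def)
  have dis: "B i \<inter> B j = {}" if "i < t" "j < t" "i \<noteq> j" for i j
    using B that by (auto simp: K_model_def)
  have unique: "i = j" if "v \<in> B i" "v \<in> B j" "i < t" "j < t" for v i j
    using dis[of i j] that by blast
  define tripods where "tripods i m Q \<longleftrightarrow> m \<in> B i \<and>
      (\<forall>j\<in>{..<t} - {i}. Q j \<noteq> [] \<and> hd (Q j) = m \<and> last (Q j) = x i j \<and> distinct (Q j) \<and>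
        set (Q j) \<subseteq> B i \<and> path_edges (Q j) \<subseteq> edges G) \<and>
      (\<forall>j\<in>{..<t} - {i}. \<forall>k\<in>{..<t} - {i}. j \<noteq> k \<longrightarrow> path_edges (Q j) \<inter> path_edges (Q k) = {})"
    for i m Q
  have "\<exists>m Q. i < t \<longrightarrow> tripods i m Q" for i
  proof (cases "i < t")
    case True
    have J: "finite ({..<t} - {i})" "card ({..<t} - {i}) \<le> 3" "x i ` ({..<t} - {i}) \<subseteq> B i"
      using x_in True t by auto
    show ?thesis
    proof (rule tripod_indexed[OF con[OF True] J])
      fix m Q
      assume "m \<in> B i"
        and "\<And>j. j \<in> {..<t} - {i} \<Longrightarrow> Q j \<noteq> [] \<and> hd (Q j) = m \<and> last (Q j) = x i j \<and>
          distinct (Q j) \<and> set (Q j) \<subseteq> B i \<and> path_edges (Q j) \<subseteq> edges G"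
        and "\<And>j k. j \<in> {..<t} - {i} \<Longrightarrow> k \<in> {..<t} - {i} \<Longrightarrow> j \<noteq> k \<Longrightarrow>
          path_edges (Q j) \<inter> path_edges (Q k) = {}"
      then have "tripods i m Q"
        unfolding tripods_def by (intro conjI ballI impI) simp_all
      then show ?thesis by blast
    qed
  qed simp
  then obtain m Q where mQ: "\<And>i. i < t \<longrightarrow> tripods i (m i) (Q i)"
    by metis
  have m: "m i \<in> B i" if "i < t" for i
    using mQ[of i] that by (simp add: tripods_def)
  have Q: "Q i j \<noteq> []" "hd (Q i j) = m i" "last (Q i j) = x i j" "distinct (Q i j)"
    "set (Q i j) \<subseteq> B i" "path_edges (Q i j) \<subseteq> edges G" if "i < t" "j < t" "j \<noteq> i" for i j
    using mQ[of i] that by (simp_all add: tripods_def)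
  have Q_dis: "path_edges (Q i j) \<inter> path_edges (Q i k) = {}"
    if "i < t" "j < t" "k < t" "j \<noteq> i" "k \<noteq> i" "j \<noteq> k" for i j k
    using mQ[of i] that by (simp add: tripods_def)
  define P where "P i j = Q i j @ rev (Q j i)" for i j
  have P: "is_path G (P i j) (m i) (m j)" if "i < j" "j < t" for i j
  proof -
    have ij: "i < t" "j \<noteq> i" "i \<noteq> j" using that by auto
    note qi = Q[OF ij(1) that(2) ij(2)] and qj = Q[OF that(2) ij(1) ij(3)]
    have "distinct (P i j)"
      using qi(4,5) qj(4,5) dis[OF ij(1) that(2) ij(3)] by (auto simp: P_def)
    moreover have "path_edges (P i j) \<subseteq> edges G"
      using qi qj x_edge[OF that] by (simp add: P_def path_edges_append hd_rev)
    moreover have "set (P i j) \<subseteq> verts G"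
      using qi(5) qj(5) sub[OF ij(1)] sub[OF that(2)] by (auto simp: P_def)
    ultimately show ?thesis
      using qi qj by (simp add: is_path_iff P_def last_rev)
  qed
  \<comment> \<open>Disjointness of the branch sets will tell apart legs in different branch sets,
    legs from crossing edges, and crossing edges of different pairs; legs in the same branch set are
    separated by \<open>Q_dis\<close>.\<close>
  have inner_or_cross: "(\<exists>a b. {a, b} = {i, j} \<and> e \<subseteq> B a \<and> e \<in> path_edges (Q a b)) \<or> e = {x i j, x j i}"
    if ij: "i < j" "j < t" and e: "e \<in> path_edges (P i j)" for i j e
  proof -
    have ij': "i < t" "j \<noteq> i" "i \<noteq> j" using ij by auto
    note qi = Q[OF ij'(1) ij(2) ij'(2)] and qj = Q[OF ij(2) ij'(1) ij'(3)]
    have "e \<in> path_edges (Q i j) \<or> e \<in> path_edges (Q j i) \<or> e = {x i j, x j i}"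
      using e qi qj by (simp add: P_def path_edges_append hd_rev) blast
    then show ?thesis
    proof (elim disjE)
      assume e: "e \<in> path_edges (Q i j)"
      then have "e \<subseteq> B i" using path_edges_subset_set qi(5) by blast
      with e show ?thesis by (intro disjI1 exI[of _ i] exI[of _ j]) simp
    next
      assume e: "e \<in> path_edges (Q j i)"
      then have "e \<subseteq> B j" using path_edges_subset_set qj(5) by blast
      with e show ?thesis by (intro disjI1 exI[of _ j] exI[of _ i]) auto
    qed simp
  qed
  have P_dis: "path_edges (P i j) \<inter> path_edges (P k l) = {}"
    if ij: "i < j" "j < t" and kl: "k < l" "l < t" and ne: "(i, j) \<noteq> (k, l)" for i j k l
  proof -
    have False if e: "e \<in> path_edges (P i j)" "e \<in> path_edges (P k l)" for e
    proof -
      have "card e = 2"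
        using P[OF ij] e path_edges_card[of "P i j" e] by (simp add: is_path_def)
      then have "e \<noteq> {}" by auto
      have bounds: "i < t" "k < t" using ij kl by auto
      have cross: "x i j \<in> B i" "x j i \<in> B j" if "i < j" "j < t" for i j
        using x_in that by auto
      consider
        a b c d where "{a, b} = {i, j}" "e \<subseteq> B a" "e \<in> path_edges (Q a b)"
          "{c, d} = {k, l}" "e \<subseteq> B c" "e \<in> path_edges (Q c d)"
        | a b where "{a, b} = {i, j}" "e \<subseteq> B a" "e = {x k l, x l k}"
        | c d where "{c, d} = {k, l}" "e \<subseteq> B c" "e = {x i j, x j i}"
        | "e = {x i j, x j i}" "e = {x k l, x l k}"
        using inner_or_cross[OF ij e(1)] inner_or_cross[OF kl e(2)] by metis
      then show False
      proof cases
        case 1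
        have "a < t" "b < t" "a \<noteq> b" "c < t" "d < t" "c \<noteq> d"
          using 1(1,4) ij kl by (auto simp: doubleton_eq_iff)
        moreover from this have "a = c"
          using dis[of a c] 1(2,5) \<open>e \<noteq> {}\<close> by blast
        moreover from this have "b \<noteq> d" using 1(1,4) ij kl ne by (auto simp: doubleton_eq_iff)
        ultimately show False using Q_dis[of a b d] 1(3,6) by simp blast
      next
        case 2
        have "a < t" using 2(1) ij by (auto simp: doubleton_eq_iff)
        moreover have "x k l \<in> B a" "x l k \<in> B a" using 2 by auto
        ultimately have "a = k" "a = l"
          using unique cross[OF kl] bounds kl(2) by simp_all
        then show False using kl by simp
      next
        case 3
        have "c < t" using 3(1) kl by (auto simp: doubleton_eq_iff)
        moreover have "x i j \<in> B c" "x j i \<in> B c" using 3 by auto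
        ultimately have "c = i" "c = j"
          using unique cross[OF ij] bounds ij(2) by simp_all
        then show False using ij by simp
      next
        case 4
        have "x i j \<in> {x k l, x l k}" "x j i \<in> {x k l, x l k}" using 4 by auto
        then have "x i j \<in> B k \<union> B l" "x j i \<in> B k \<union> B l" using cross[OF kl] by auto
        then have "i \<in> {k, l}" "j \<in> {k, l}"
          using unique[OF cross(1)[OF ij]] unique[OF cross(2)[OF ij]] bounds ij(2) kl(2) by blast+
        then show False using ij(1) kl(1) ne by auto
      qed
    qed
    then show ?thesis by blast
  qed
  have "inj_on m {..<t}"
    using m unique by (intro inj_onI) (metis lessThan_iff)
  moreover have "m ` {..<t} \<subseteq> verts G" using m sub by blast
  ultimately show ?thesis
    unfolding has_K_immersion_def using P P_dis
    by (intro exI[of _ m] exI[of _ P] conjI allI impI) (simp_all del: prod.inject)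
qed

section \<open>Minors from minimum degree\<close>

definition path_in :: "'a set \<Rightarrow> 'a set set \<Rightarrow> 'a list \<Rightarrow> bool" where
  "path_in W E p \<longleftrightarrow> p \<noteq> [] \<and> distinct p \<and> set p \<subseteq> W \<and> path_edges p \<subseteq> E"

definition longest_path_in :: "'a set \<Rightarrow> 'a set set \<Rightarrow> 'a list \<Rightarrow> bool" where
  "longest_path_in W E p \<longleftrightarrow> path_in W E p \<and> (\<forall>q. path_in W E q \<longrightarrow> length q \<le> length p)"

lemma longest_path_in_exists:
  assumes "finite W" and "W \<noteq> {}"
  shows "\<exists>p. longest_path_in W E p"
proof -
  obtain v where "v \<in> W" using assms by blast
  then have "path_in W E [v]" by (simp add: path_in_def)
  moreover have "length p < Suc (card W)" if "path_in W E p" for p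
    using that assms(1) by (metis card_mono distinct_card le_imp_less_Suc path_in_def)
  ultimately show ?thesis
    unfolding longest_path_in_def using ex_has_greatest_nat[of "path_in W E" "[v]" length "Suc (card W)"]
    by blast
qed

text \<open>A neighbour of the start off the path could be put in front of it, so all neighbours lie
  on a longest path. The indices in \<open>A\<close> are too few to account for all of them.\<close>

lemma longest_path_in_neighbour:
  assumes p: "longest_path_in W E p" and W: "finite W" and loopless: "{p ! 0} \<notin> E"
    and A: "finite A" "card A < card {x \<in> W. {p ! 0, x} \<in> E}"
  obtains m where "0 < m" "m < length p" "m \<notin> A" "{p ! 0, p ! m} \<in> E"
proof -
  have "card ((!) p ` A) < card {x \<in> W. {p ! 0, x} \<in> E}"
    using card_image_le[OF A(1), of "(!) p"] A(2) by linarith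
  then have "\<not> {x \<in> W. {p ! 0, x} \<in> E} \<subseteq> (!) p ` A"
    using card_mono[OF finite_imageI[OF A(1)], of _ "(!) p"] by (meson not_less)
  then obtain x where x: "x \<in> W" "{p ! 0, x} \<in> E" "x \<notin> (!) p ` A" by blast
  have "x \<in> set p"
  proof (rule ccontr)
    assume "x \<notin> set p"
    then have "path_in W E (x # p)"
      using p x by (cases p) (auto simp: longest_path_in_def path_in_def insert_commute)
    then show False using p unfolding longest_path_in_def by fastforce
  qed
  then obtain m where m: "m < length p" "x = p ! m" by (metis in_set_conv_nth)
  moreover have "m \<noteq> 0" using m x loopless by (cases m) auto
  moreover have "m \<notin> A" using m x by blast
  ultimately show ?thesis using that x by blast
qed

text \<open>The path is cut at the positions \<open>c\<close> into consecutive segments.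
  Neighbouring segments are joined by an edge of the path, so \<open>adj\<close> concerns only
  segments that are not consecutive.\<close>

lemma K_model_segments:
  assumes p: "path_in W E p" and mono: "\<And>i. i < t \<Longrightarrow> c i < c (Suc i)" and len: "c t \<le> length p"
    and adj: "\<And>i j. Suc i < j \<Longrightarrow> j < t \<Longrightarrow>
      \<exists>a b. c i \<le> a \<and> a < c (Suc i) \<and> c j \<le> b \<and> b < c (Suc j) \<and> {p ! a, p ! b} \<in> E"
  shows "K_model (W, E) t (\<lambda>i. (!) p ` {c i..<c (Suc i)})"
proof -
  have c_mono: "c i \<le> c j" if "i \<le> j" "j \<le> t" for i j
    using that
  proof (induction j rule: dec_induct)
    case (step n)
    then show ?case using mono[of n] by simp
  qed simp
  show ?thesis
  proof (rule K_modelI)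
    have c_len: "c (Suc i) \<le> length p" if "i < t" for i
      using c_mono[of "Suc i" t] that len by simp
    fix i assume i: "i < t"
    show "(!) p ` {c i..<c (Suc i)} \<subseteq> verts (W, E)"
      using p c_len[OF i] by (auto simp: path_in_def verts_def subset_iff)
    show "connected_in (edges (W, E)) ((!) p ` {c i..<c (Suc i)})"
      using p mono[OF i] c_len[OF i]
      by (intro connected_in_segment) (auto simp: path_in_def edges_def)
  next
    fix i j assume ij: "i < j" "j < t"
    have le: "c (Suc i) \<le> c j" "c (Suc j) \<le> length p"
      using c_mono[of "Suc i" j] c_mono[of "Suc j" t] ij len by auto
    have "p ! a \<noteq> p ! b" if "a < c (Suc i)" "c j \<le> b" "b < c (Suc j)" for a b
      using that p le by (auto simp: path_in_def nth_eq_iff_index_eq)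
    then show "(!) p ` {c i..<c (Suc i)} \<inter> (!) p ` {c j..<c (Suc j)} = {}"
      by force
    show "\<exists>x\<in>(!) p ` {c i..<c (Suc i)}. \<exists>y\<in>(!) p ` {c j..<c (Suc j)}. {x, y} \<in> edges (W, E)"
    proof (cases "j = Suc i")
      case True
      \<comment> \<open>\<open>a\<close> is the last index of segment \<open>i\<close>, and
        \<open>Suc a\<close> the first index of segment \<open>j\<close>.\<close>
      obtain a where a: "c (Suc i) = Suc a" using mono[of i] ij by (cases "c (Suc i)") auto
      have "{p ! a, p ! Suc a} \<in> E"
        using p mono[OF ij(2)] le a True by (auto simp: path_in_def path_edges_subset_iff)
      moreover have "a \<in> {c i..<c (Suc i)}" "Suc a \<in> {c j..<c (Suc j)}"
        using a mono[of i] mono[of j] ij True by auto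
      ultimately show ?thesis unfolding edges_def snd_conv by blast
    next
      case False
      then obtain a b where "a \<in> {c i..<c (Suc i)}" "b \<in> {c j..<c (Suc j)}" "{p ! a, p ! b} \<in> E"
        using adj[of i j] ij by auto
      then show ?thesis unfolding edges_def snd_conv by blast
    qed
  qed
qed

text \<open>The start of a longest path has a neighbour \<open>p\<^sub>m\<close> with
  \<open>m \<ge> 2\<close>. The resulting cycle is cut into \<open>p\<^sub>0\<close>, the vertices
  strictly between, and \<open>p\<^sub>m\<close>.\<close>

lemma min_degree_2_K_model:
  assumes W: "finite W" "W \<noteq> {}" and loopless: "\<And>v. {v} \<notin> E"
    and deg: "\<And>v. v \<in> W \<Longrightarrow> 2 \<le> card {x \<in> W. {v, x} \<in> E}"
  shows "\<exists>B. K_model (W, E) 3 B"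
proof -
  obtain p where p: "longest_path_in W E p" using longest_path_in_exists W by blast
  then have path: "path_in W E p" by (simp add: longest_path_in_def)
  then have "p ! 0 \<in> W" by (auto simp: path_in_def)
  then obtain m where m: "0 < m" "m < length p" "m \<noteq> 1" "{p ! 0, p ! m} \<in> E"
    using longest_path_in_neighbour[OF p W(1) loopless, of "{1}"] deg[of "p ! 0"] by auto
  have "K_model (W, E) 3 (\<lambda>i. (!) p ` {[0, 1, m, Suc m] ! i..<[0, 1, m, Suc m] ! Suc i})"
  proof (rule K_model_segments[OF path])
    show "[0, 1, m, Suc m] ! i < [0, 1, m, Suc m] ! Suc i" if "i < 3" for i
      using that m by (auto simp: less_Suc_eq numeral_eq_Suc)
    show "[0, 1, m, Suc m] ! 3 \<le> length p" using m by simp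
    fix i j :: nat assume "Suc i < j" "j < 3"
    then have "i = 0" "j = 2" by auto
    then show "\<exists>a b. [0, 1, m, Suc m] ! i \<le> a \<and> a < [0, 1, m, Suc m] ! Suc i \<and>
        [0, 1, m, Suc m] ! j \<le> b \<and> b < [0, 1, m, Suc m] ! Suc j \<and> {p ! a, p ! b} \<in> E"
      using m by (intro exI[of _ 0] exI[of _ m]) (simp add: numeral_eq_Suc)
  qed
  then show ?thesis by blast
qed

text \<open>Take a longest path \<open>p\<^sub>0 p\<^sub>1 \<dots>\<close> whose start has neighbours \<open>p\<^sub>i\<close>, \<open>p\<^sub>j\<close> with \<open>2 \<le> i < j\<close> and
  \<open>i\<close> minimal over all longest paths. Reversing \<open>p\<^sub>0 \<dots> p\<^bsub>i - 1\<^esub>\<close> gives another longest path, so by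
  minimality \<open>p\<^bsub>i - 1\<^esub>\<close> has a neighbour \<open>p\<^sub>m\<close> with \<open>m > i\<close>, and the path splits
  into four branch sets.\<close>

lemma min_degree_3_K_model:
  assumes W: "finite W" "W \<noteq> {}" and loopless: "\<And>v. {v} \<notin> E"
    and deg: "\<And>v. v \<in> W \<Longrightarrow> 3 \<le> card {x \<in> W. {v, x} \<in> E}"
  shows "\<exists>B. K_model (W, E) 4 B"
proof -
  have neighbour: "\<exists>m. 0 < m \<and> m < length p \<and> m \<noteq> a \<and> m \<noteq> b \<and> {p ! 0, p ! m} \<in> E"
    if p: "longest_path_in W E p" for p a b
  proof -
    have "p ! 0 \<in> W" using p by (auto simp: longest_path_in_def path_in_def)
    then have "card {a, b} < card {x \<in> W. {p ! 0, x} \<in> E}"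
      using deg[of "p ! 0"] card_insert_le_m1[of 2 "{b}" a] by simp
    then show ?thesis
      using longest_path_in_neighbour[OF p W(1) loopless, of "{a, b}"] by auto
  qed
  define fan where "fan i \<longleftrightarrow> (\<exists>p j. longest_path_in W E p \<and> 2 \<le> i \<and> i < j \<and> j < length p \<and>
    {p ! 0, p ! i} \<in> E \<and> {p ! 0, p ! j} \<in> E)" for i
  obtain p0 where p0: "longest_path_in W E p0" using longest_path_in_exists W by blast
  obtain k where k: "0 < k" "k < length p0" "k \<noteq> 1" "{p0 ! 0, p0 ! k} \<in> E"
    using neighbour[OF p0, of 1 1] by blast
  obtain l where l: "0 < l" "l < length p0" "l \<noteq> 1" "l \<noteq> k" "{p0 ! 0, p0 ! l} \<in> E"
    using neighbour[OF p0, of 1 k] by blast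
  have "fan (min k l)"
    unfolding fan_def using p0 k l
    by (intro exI[of _ p0] exI[of _ "max k l"]) (auto simp: min_def max_def)
  then have fan: "fan (LEAST i. fan i)" by (rule LeastI)
  define i where "i = (LEAST i. fan i)"
  obtain p j where p: "longest_path_in W E p" and ij: "2 \<le> i" "i < j" "j < length p"
    "{p ! 0, p ! i} \<in> E" "{p ! 0, p ! j} \<in> E"
    using fan unfolding fan_def i_def by blast
  have path: "path_in W E p" using p by (simp add: longest_path_in_def)
  define q where "q = rev (take i p) @ drop i p"
  have len: "length q = length p" using ij by (simp add: q_def)
  have "hd (drop i p) = p ! i" using ij by (simp add: hd_drop_conv_nth)
  moreover have "last (rev (take i p)) = p ! 0" using ij by (cases p) (auto simp: last_rev hd_conv_nth)
  moreover have "path_edges (take i p) \<union> path_edges (drop i p) \<subseteq> path_edges (take i p @ drop i p)"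
    unfolding path_edges_append by blast
  ultimately have "path_edges q \<subseteq> E"
    using path ij unfolding q_def by (auto simp: path_edges_append path_in_def)
  moreover have "distinct q" "set q = set p"
  proof -
    have "distinct (take i p @ drop i p)" using path by (simp add: path_in_def)
    then show "distinct q" unfolding q_def by (simp del: append_take_drop_id)
    have "set q = set (take i p @ drop i p)" unfolding q_def by (simp del: append_take_drop_id)
    then show "set q = set p" by simp
  qed
  ultimately have q: "longest_path_in W E q"
    using p len by (auto simp: longest_path_in_def path_in_def)
  have q_lt: "q ! k = p ! (i - 1 - k)" if "k < i" for k
    using that ij by (simp add: q_def nth_append rev_nth)
  have q_ge: "q ! k = p ! k" if "i \<le> k" for k
    using that ij by (simp add: q_def nth_append)
  obtain m where m: "0 < m" "m < length p" "m \<noteq> 1" "m \<noteq> i" "{q ! 0, q ! m} \<in> E"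
    using neighbour[OF q, of 1 i] len by auto
  \<comment> \<open>\<open>q\<close> starts at \<open>p ! (i - 1)\<close>, whose edge to
    \<open>p ! i\<close> is the path edge lost by the reversal.\<close>
  have edge_q: "{q ! 0, q ! i} \<in> E"
    using path ij q_lt[of 0] q_ge[of i]
    by (auto simp: path_in_def path_edges_subset_iff dest!: spec[of _ "i - 1"])
  \<comment> \<open>Otherwise \<open>q\<close> with the neighbours at positions \<open>m\<close> and
    \<open>i\<close> would witness \<open>fan m\<close> with \<open>m < i\<close>.\<close>
  have "i < m"
  proof (rule ccontr)
    assume "\<not> i < m"
    then have "fan m"
      unfolding fan_def using q m edge_q ij len by (intro exI[of _ q] exI[of _ i]) auto
    then show False using \<open>\<not> i < m\<close> m Least_le[of fan m] by (simp add: i_def)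
  qed
  then have im: "{p ! (i - 1), p ! m} \<in> E" using m q_lt[of 0] q_ge[of m] ij by auto
  \<comment> \<open>The cut points of the four branch sets. Besides the path edges, the first and
    third are joined by \<open>p ! 0\<close> and \<open>p ! i\<close>, the first and last by
    \<open>p ! 0\<close> and \<open>p ! j\<close>, the second and last by \<open>p ! (i - 1)\<close>
    and \<open>p ! m\<close>.\<close>
  let ?c = "(!) [0, i - 1, i, min m j, Suc (max m j)]"
  have "K_model (W, E) 4 (\<lambda>k. (!) p ` {?c k..<?c (Suc k)})"
  proof (rule K_model_segments[OF path])
    show "?c k < ?c (Suc k)" if "k < 4" for k
      using that ij \<open>i < m\<close> by (auto simp: less_Suc_eq numeral_eq_Suc)
    show "?c 4 \<le> length p" using m ij by simp
    fix k l :: nat assume "Suc k < l" "l < 4"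
    then consider "k = 0" "l = 2" | "k = 0" "l = 3" | "k = 1" "l = 3" by linarith
    then show "\<exists>a b. ?c k \<le> a \<and> a < ?c (Suc k) \<and> ?c l \<le> b \<and> b < ?c (Suc l) \<and> {p ! a, p ! b} \<in> E"
    proof cases
      case 1
      then show ?thesis
        using ij \<open>i < m\<close> by (intro exI[of _ 0] exI[of _ i]) (simp add: numeral_eq_Suc)
    next
      case 2
      then show ?thesis
        using ij \<open>i < m\<close> by (intro exI[of _ 0] exI[of _ j]) (simp add: numeral_eq_Suc)
    next
      case 3
      then show ?thesis
        using ij \<open>i < m\<close> im by (intro exI[of _ "i - 1"] exI[of _ m]) (simp add: numeral_eq_Suc)
    qed
  qed
  then show ?thesis by blast
qed

section \<open>Path systems with few crossings\<close>

definition pairs :: "nat \<Rightarrow> nat set set" where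
  "pairs t = {e. e \<subseteq> {..<t} \<and> card e = 2}"

text \<open>Paths are indexed by unordered pairs and their direction is left open. Edge-disjointness
  is kept out of the notion, since contracting a vertex can merge edges of different paths.\<close>

definition linkage :: "(nat \<Rightarrow> 'a) \<Rightarrow> (nat set \<Rightarrow> 'a list) \<Rightarrow> nat \<Rightarrow> bool" where
  "linkage \<phi> P t \<longleftrightarrow> inj_on \<phi> {..<t} \<and>
     (\<forall>e\<in>pairs t. P e \<noteq> [] \<and> distinct (P e) \<and> {hd (P e), last (P e)} = \<phi> ` e)"

definition linkage_graph :: "(nat set \<Rightarrow> 'a list) \<Rightarrow> nat \<Rightarrow> 'a graph" where
  "linkage_graph P t = ((\<Union>e\<in>pairs t. set (P e)), (\<Union>e\<in>pairs t. path_edges (P e)))"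

definition path_nbrs :: "'a list \<Rightarrow> 'a \<Rightarrow> 'a set" where
  "path_nbrs p v = {x. {v, x} \<in> path_edges p}"

lemma pairs_iff: "e \<in> pairs t \<longleftrightarrow> (\<exists>i j. i < j \<and> j < t \<and> e = {i, j})"
proof
  assume "e \<in> pairs t"
  then obtain i j where "e = {i, j}" "i \<noteq> j" "e \<subseteq> {..<t}"
    by (auto simp: pairs_def card_2_iff)
  then have "i < j \<and> j < t \<and> e = {i, j} \<or> j < i \<and> i < t \<and> e = {j, i}" by auto
  then show "\<exists>i j. i < j \<and> j < t \<and> e = {i, j}" by blast
qed (auto simp: pairs_def)

lemma doubleton_in_pairs: "i < t \<Longrightarrow> j < t \<Longrightarrow> i \<noteq> j \<Longrightarrow> {i, j} \<in> pairs t"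
  by (simp add: pairs_def)

lemma finite_pairs [simp]: "finite (pairs t)"
  by (rule finite_subset[of _ "Pow {..<t}"]) (auto simp: pairs_def)

lemma path_nbrs_subset: "path_nbrs p v \<subseteq> set p"
  using path_edges_subset_set[of _ p] by (auto simp: path_nbrs_def)

lemma finite_path_nbrs [simp]: "finite (path_nbrs p v)"
  by (rule finite_subset[OF path_nbrs_subset]) simp

lemma path_nbrs_irrefl: "distinct p \<Longrightarrow> v \<notin> path_nbrs p v"
  using path_edges_card[of p "{v, v}"] by (auto simp: path_nbrs_def)

lemma interior_split:
  assumes "v \<in> set p" and "v \<noteq> hd p" and "v \<noteq> last p"
  obtains xs a b ys where "p = xs @ [a, v, b] @ ys"
proof -
  obtain q r where qr: "p = q @ v # r" using split_list[OF assms(1)] by blast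
  then have "q \<noteq> []" "r \<noteq> []" using assms by auto
  then obtain xs a b ys where "q = xs @ [a]" "r = b # ys"
    by (metis list.exhaust rev_exhaust)
  then show ?thesis using that qr by simp
qed

lemma path_nbrs_interior:
  assumes "v \<in> set p" and "v \<noteq> hd p" and "v \<noteq> last p" and "distinct p"
  obtains a b where "a \<noteq> b" "path_nbrs p v = {a, b}"
proof -
  obtain xs a b ys where p: "p = xs @ [a, v, b] @ ys"
    using interior_split[OF assms(1-3)] .
  have "path_edges p = path_edges (xs @ [a]) \<union> {{a, v}, {v, b}} \<union> path_edges (b # ys)"
    unfolding p by (cases ys) (auto simp: path_edges_append)
  moreover have "{v, x} \<notin> path_edges (xs @ [a])" "{v, x} \<notin> path_edges (b # ys)" for x
    using path_edges_subset_set[of "{v, x}"] assms(4) unfolding p by fastforce+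
  ultimately have "path_nbrs p v = {a, b}"
    by (auto simp: path_nbrs_def doubleton_eq_iff)
  moreover have "a \<noteq> b" using assms(4) by (simp add: p)
  ultimately show ?thesis using that by blast
qed

lemma path_nbrs_nonempty:
  assumes "v \<in> set p" and "hd p \<noteq> last p"
  shows "path_nbrs p v \<noteq> {}"
proof -
  obtain q r where p: "p = q @ v # r" using split_list[OF assms(1)] by blast
  show ?thesis
  proof (cases r)
    case Nil
    then obtain xs a where "q = xs @ [a]" using assms(2) p by (cases q rule: rev_cases) auto
    then show ?thesis using p Nil by (auto simp: path_nbrs_def path_edges_append insert_commute)
  next
    case (Cons b ys)
    then have "{v, b} \<in> path_edges p" by (simp add: p path_edges_append)
    then show ?thesis by (auto simp: path_nbrs_def)
  qed
qed

text \<open>Dropping \<open>w\<close> replaces a stretch \<open>a\<close>, \<open>w\<close>,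
  \<open>b\<close> by the edge \<open>{a, b}\<close>. As \<open>u\<close> is one of \<open>a\<close>
  and \<open>b\<close>, this is the other edge at \<open>w\<close> moved to \<open>u\<close>, the
  form that \<open>K_model_uncontract\<close> expects.\<close>

lemma path_edges_filter:
  assumes v: "w \<in> set p" "w \<noteq> hd p" "w \<noteq> last p" "distinct p" and u: "u \<in> path_nbrs p w"
    and xy: "{x, y} \<in> path_edges (filter (\<lambda>z. z \<noteq> w) p)"
  shows "{x, y} \<in> path_edges p \<or> x = u \<and> {w, y} \<in> path_edges p \<or> y = u \<and> {w, x} \<in> path_edges p"
proof -
  obtain xs a b ys where p: "p = xs @ [a, w, b] @ ys"
    using interior_split[OF v(1-3)] .
  have p_edges: "path_edges p = path_edges (xs @ [a]) \<union> {{a, w}, {w, b}} \<union> path_edges (b # ys)"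
    unfolding p by (cases ys) (auto simp: path_edges_append)
  have "filter (\<lambda>z. z \<noteq> w) xs = xs" "filter (\<lambda>z. z \<noteq> w) ys = ys"
    using v(4) by (auto simp: p filter_id_conv)
  then have "filter (\<lambda>z. z \<noteq> w) p = (xs @ [a]) @ (b # ys)"
    using v(4) by (auto simp: p)
  moreover have "path_edges ((xs @ [a]) @ (b # ys)) = path_edges (xs @ [a]) \<union> path_edges (b # ys) \<union> {{a, b}}"
    by (subst path_edges_append) simp
  ultimately have "path_edges (filter (\<lambda>z. z \<noteq> w) p) = path_edges (xs @ [a]) \<union> path_edges (b # ys) \<union> {{a, b}}"
    by (simp only:)
  then have "{x, y} \<in> path_edges (xs @ [a]) \<union> {{a, b}} \<union> path_edges (b # ys)"
    using xy by blast
  moreover have "u \<in> {a, b}"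
  proof -
    have "{w, u} \<notin> path_edges (xs @ [a])" "{w, u} \<notin> path_edges (b # ys)"
      using path_edges_subset_set[of "{w, u}"] v(4) unfolding p by fastforce+
    then show ?thesis using u by (auto simp: path_nbrs_def p_edges doubleton_eq_iff)
  qed
  ultimately show ?thesis
    unfolding p_edges by (auto simp: doubleton_eq_iff insert_commute)
qed

lemma hd_filter_neq: "p \<noteq> [] \<Longrightarrow> hd p \<noteq> w \<Longrightarrow> hd (filter (\<lambda>z. z \<noteq> w) p) = hd p"
  by (cases p) auto

lemma last_filter_neq: "p \<noteq> [] \<Longrightarrow> last p \<noteq> w \<Longrightarrow> last (filter (\<lambda>z. z \<noteq> w) p) = last p"
  by (cases p rule: rev_cases) auto

lemma linkage_ends:
  assumes "linkage \<phi> P t" and "e \<in> pairs t"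
  shows "hd (P e) \<in> \<phi> ` e" "last (P e) \<in> \<phi> ` e" "hd (P e) \<noteq> last (P e)"
    "\<phi> ` e \<subseteq> set (P e)" "distinct (P e)" "P e \<noteq> []"
proof -
  have e: "{hd (P e), last (P e)} = \<phi> ` e" and d: "distinct (P e)" "P e \<noteq> []"
    using assms by (auto simp: linkage_def)
  show "hd (P e) \<in> \<phi> ` e" "last (P e) \<in> \<phi> ` e" using e by blast+
  show "\<phi> ` e \<subseteq> set (P e)" unfolding e[symmetric] using d by simp
  have "inj_on \<phi> e" using assms by (auto simp: linkage_def pairs_def intro: inj_on_subset)
  then have "card (\<phi> ` e) = 2" using assms(2) by (simp add: card_image pairs_def)
  then have "card {hd (P e), last (P e)} = 2" using e by simp
  then show "hd (P e) \<noteq> last (P e)" by auto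
  show "distinct (P e)" "P e \<noteq> []" by fact+
qed

lemma linkage_graph_nbrs:
  "{x. {v, x} \<in> edges (linkage_graph P t)} = (\<Union>e\<in>pairs t. path_nbrs (P e) v)"
  by (auto simp: linkage_graph_def edges_def path_nbrs_def)

lemma linkage_graph_edges_card:
  assumes "linkage \<phi> P t" and "e \<in> edges (linkage_graph P t)"
  shows "card e = 2" "e \<subseteq> verts (linkage_graph P t)"
  using assms path_edges_card path_edges_subset_set
  by (fastforce simp: linkage_graph_def edges_def verts_def linkage_def)+

text \<open>Contracting \<open>w\<close> into \<open>u\<close> preserves the path system. If \<open>v\<close> is not a branch vertex, \<open>w = v\<close>
  works; if it is, two of its three paths leave through the same neighbour, which is taken as \<open>w\<close>.\<close>

lemma linkage_K4_reducible_vertex: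
  assumes P: "linkage \<phi> P 4"
    and avoid: "\<And>e k. e \<in> pairs 4 \<Longrightarrow> k < 4 \<Longrightarrow> \<phi> k \<in> set (P e) \<Longrightarrow> k \<in> e"
    and two: "\<And>v. v \<notin> \<phi> ` {..<4} \<Longrightarrow> card {e \<in> pairs 4. v \<in> set (P e)} \<le> 2"
    and v: "v \<in> verts (linkage_graph P 4)" "card {x. {v, x} \<in> edges (linkage_graph P 4)} \<le> 2"
  shows "\<exists>w u. w \<notin> \<phi> ` {..<4} \<and> w \<in> verts (linkage_graph P 4) \<and>
    (\<forall>e\<in>pairs 4. w \<in> set (P e) \<longrightarrow> u \<in> path_nbrs (P e) w)"
proof -
  define N where "N = (\<Union>e\<in>pairs 4. path_nbrs (P e) v)"
  have N: "finite N" "card N \<le> 2"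
    using v(2) unfolding N_def linkage_graph_nbrs by auto
  obtain e0 where e0: "e0 \<in> pairs 4" "v \<in> set (P e0)"
    using v(1) by (auto simp: linkage_graph_def verts_def)
  show ?thesis
  proof (cases "v \<in> \<phi> ` {..<4}")
    case False
    have nbrs: "\<exists>a b. a \<noteq> b \<and> path_nbrs (P e) v = {a, b}" if "e \<in> pairs 4" "v \<in> set (P e)" for e
    proof -
      have "\<phi> ` e \<subseteq> \<phi> ` {..<4}" using that(1) by (auto simp: pairs_def)
      then have "v \<noteq> hd (P e)" "v \<noteq> last (P e)"
        using linkage_ends[OF P that(1)] False by auto
      then show ?thesis
        using path_nbrs_interior[OF that(2)] linkage_ends(5)[OF P that(1)] by metis
    qed
    \<comment> \<open>A path through \<open>v\<close> already uses two neighbours, and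
      \<open>N\<close> has room for no more; so all these paths have the same neighbours.\<close>
    have all: "path_nbrs (P e) v = N" if "e \<in> pairs 4" "v \<in> set (P e)" for e
    proof (rule card_seteq[OF N(1)])
      show "path_nbrs (P e) v \<subseteq> N" using that by (auto simp: N_def)
      have "card (path_nbrs (P e) v) = 2" using nbrs[OF that] by auto
      then show "card N \<le> card (path_nbrs (P e) v)" using N by simp
    qed
    obtain u where "u \<in> N" using nbrs[OF e0] all[OF e0] by auto
    then show ?thesis
      using False v(1) all by (intro exI[of _ v] exI[of _ u]) simp
  next
    case True
    then obtain k where k: "k < 4" "v = \<phi> k" by auto
    have "\<exists>x. x \<in> path_nbrs (P {k, j}) v" if "j \<in> {..<4} - {k}" for j
    proof -
      have e: "{k, j} \<in> pairs 4" using that k by (auto simp: doubleton_in_pairs)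
      have "v \<in> set (P {k, j})" using linkage_ends(4)[OF P e] k by auto
      then show ?thesis using path_nbrs_nonempty linkage_ends(3)[OF P e] by fast
    qed
    then have "\<forall>j\<in>{..<4} - {k}. \<exists>x. x \<in> path_nbrs (P {k, j}) v" by blast
    from bchoice[OF this] obtain n where n: "\<forall>j\<in>{..<4} - {k}. n j \<in> path_nbrs (P {k, j}) v"
      by blast
    have "n j \<in> N" if "j \<in> {..<4} - {k}" for j
    proof -
      have "{k, j} \<in> pairs 4" using that k by (auto simp: doubleton_in_pairs)
      then show ?thesis using n that unfolding N_def by blast
    qed
    then have "n ` ({..<4} - {k}) \<subseteq> N" by blast
    then have "card (n ` ({..<4} - {k})) \<le> card N" by (rule card_mono[OF N(1)])
    moreover have "card ({..<4} - {k}) = 3" using k by simp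
    \<comment> \<open>The three paths ending at \<open>v\<close> leave through at most two
      neighbours, so two of them share one.\<close>
    ultimately have "\<not> inj_on n ({..<4} - {k})" using N(2) by (auto dest: card_image)
    then obtain i j where ij: "i < 4" "j < 4" "i \<noteq> k" "j \<noteq> k" "i \<noteq> j" "n i = n j"
      by (auto simp: inj_on_def)
    define x where "x = n i"
    have x: "x \<in> path_nbrs (P {k, i}) v" "x \<in> path_nbrs (P {k, j}) v"
      using bspec[OF n, of i] bspec[OF n, of j] ij by (auto simp: x_def)
    have pairs: "{k, i} \<in> pairs 4" "{k, j} \<in> pairs 4"
      using ij k by (auto simp: doubleton_in_pairs)
    have x_on: "x \<in> set (P {k, i})" "x \<in> set (P {k, j})"
      using x path_nbrs_subset by fast+
    have "x \<noteq> v" using x(1) path_nbrs_irrefl linkage_ends(5)[OF P pairs(1)] by fast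
    \<comment> \<open>By \<open>avoid\<close>, a branch vertex on both paths can only be their
      common end \<open>v\<close>.\<close>
    have x_nonbranch: "x \<notin> \<phi> ` {..<4}"
    proof
      assume "x \<in> \<phi> ` {..<4}"
      then obtain l where l: "l < 4" "x = \<phi> l" by auto
      then have "l \<in> {k, i}" "l \<in> {k, j}" using avoid pairs x_on by auto
      then show False using ij l k \<open>x \<noteq> v\<close> by auto
    qed
    \<comment> \<open>\<open>x\<close> lies on these two paths, and by \<open>two\<close> on no
      third one.\<close>
    have on_x: "{{k, i}, {k, j}} = {e \<in> pairs 4. x \<in> set (P e)}"
    proof (rule card_seteq)
      have "card {{k, i}, {k, j}} = 2" using ij by (auto simp: doubleton_eq_iff)
      then show "card {e \<in> pairs 4. x \<in> set (P e)} \<le> card {{k, i}, {k, j}}"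
        using two[OF x_nonbranch] by simp
    qed (use pairs x_on in simp_all)
    have "v \<in> path_nbrs (P e) x" if "e \<in> pairs 4" "x \<in> set (P e)" for e
    proof -
      have "e \<in> {{k, i}, {k, j}}" unfolding on_x using that by simp
      then have "x \<in> path_nbrs (P e) v" using x by blast
      then show ?thesis by (simp add: path_nbrs_def insert_commute)
    qed
    moreover have "x \<in> verts (linkage_graph P 4)"
      using x_on pairs by (auto simp: linkage_graph_def verts_def)
    ultimately show ?thesis
      using x_nonbranch by (intro exI[of _ x] exI[of _ v]) simp
  qed
qed

text \<open>Induction on the number of vertices of the union. Minimum degree 3 gives the model at
  once. Otherwise some \<open>w\<close> is dropped from all paths; they only lose vertices, so the
  assumptions persist, and the smaller model is pulled back by
  \<open>K_model_uncontract\<close>.\<close>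

lemma linkage_K4_model:
  assumes "linkage \<phi> P 4"
    and "\<And>e k. e \<in> pairs 4 \<Longrightarrow> k < 4 \<Longrightarrow> \<phi> k \<in> set (P e) \<Longrightarrow> k \<in> e"
    and "\<And>v. v \<notin> \<phi> ` {..<4} \<Longrightarrow> card {e \<in> pairs 4. v \<in> set (P e)} \<le> 2"
  shows "\<exists>B. K_model (linkage_graph P 4) 4 B"
  using assms
proof (induction "card (verts (linkage_graph P 4))" arbitrary: P rule: less_induct)
  case less
  note P = less.prems(1) and avoid = less.prems(2) and two = less.prems(3)
  let ?G = "linkage_graph P 4"
  have fin: "finite (verts ?G)" by (simp add: linkage_graph_def verts_def)
  have nbrs: "{x \<in> verts ?G. {v, x} \<in> edges ?G} = {x. {v, x} \<in> edges ?G}" for v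
    using linkage_graph_edges_card(2)[OF P] by blast
  show ?case
  proof (cases "\<forall>v\<in>verts ?G. 3 \<le> card {x. {v, x} \<in> edges ?G}")
    case True
    have "{0, 1} \<in> pairs 4" by (rule doubleton_in_pairs) auto
    then have "verts ?G \<noteq> {}"
      using linkage_ends(6)[OF P] by (auto simp: linkage_graph_def verts_def)
    moreover have "{v} \<notin> edges ?G" for v using linkage_graph_edges_card(1)[OF P, of "{v}"] by auto
    ultimately have "\<exists>B. K_model (verts ?G, edges ?G) 4 B"
      using min_degree_3_K_model[OF fin] True nbrs by simp
    then show ?thesis by (simp add: verts_def edges_def)
  next
    case False
    then obtain v where v: "v \<in> verts ?G" "card {x. {v, x} \<in> edges ?G} \<le> 2" by force
    obtain w u where w: "w \<notin> \<phi> ` {..<4}" "w \<in> verts ?G"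
      and u: "\<And>e. e \<in> pairs 4 \<Longrightarrow> w \<in> set (P e) \<Longrightarrow> u \<in> path_nbrs (P e) w"
      using linkage_K4_reducible_vertex[OF P _ _ v] avoid two by blast
    define P' where "P' e = filter (\<lambda>x. x \<noteq> w) (P e)" for e
    have ends: "hd (P e) \<noteq> w" "last (P e) \<noteq> w" if "e \<in> pairs 4" for e
    proof -
      have "\<phi> ` e \<subseteq> \<phi> ` {..<4}" using that by (auto simp: pairs_def)
      then show "hd (P e) \<noteq> w" "last (P e) \<noteq> w" using linkage_ends[OF P that] w(1) by auto
    qed
    have P': "linkage \<phi> P' 4"
      unfolding linkage_def
    proof (intro conjI ballI)
      show "inj_on \<phi> {..<4}" using P by (simp add: linkage_def)
      fix e assume e: "e \<in> pairs 4"
      note le = linkage_ends[OF P e]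
      show "P' e \<noteq> []"
        using le(6) ends(1)[OF e] hd_in_set[OF le(6)] by (auto simp: P'_def filter_empty_conv)
      show "distinct (P' e)" using le(5) by (simp add: P'_def)
      show "{hd (P' e), last (P' e)} = \<phi> ` e"
        using P e le(6) ends[OF e] by (simp add: P'_def hd_filter_neq last_filter_neq linkage_def)
    qed
    have verts': "verts (linkage_graph P' 4) = verts ?G - {w}"
      by (auto simp: linkage_graph_def verts_def P'_def)
    have "\<exists>B. K_model (linkage_graph P' 4) 4 B"
    proof (rule less.hyps[OF _ P'])
      show "card (verts (linkage_graph P' 4)) < card (verts ?G)"
        unfolding verts' using fin w(2) by (meson card_Diff1_less)
      show "k \<in> e" if "e \<in> pairs 4" "k < 4" "\<phi> k \<in> set (P' e)" for e k
        using avoid that by (simp add: P'_def)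
      fix v assume "v \<notin> \<phi> ` {..<4}"
      then have "card {e \<in> pairs 4. v \<in> set (P e)} \<le> 2" by (rule two)
      moreover have "card {e \<in> pairs 4. v \<in> set (P' e)} \<le> card {e \<in> pairs 4. v \<in> set (P e)}"
        by (rule card_mono) (auto simp: P'_def)
      ultimately show "card {e \<in> pairs 4. v \<in> set (P' e)} \<le> 2" by linarith
    qed
    then obtain B where B: "K_model (linkage_graph P' 4) 4 B" by blast
    have "K_model ?G 4 (\<lambda>i. if u \<in> B i then insert w (B i) else B i)"
    proof (rule K_model_uncontract[OF B])
      show "verts (linkage_graph P' 4) \<subseteq> verts ?G" "w \<notin> verts (linkage_graph P' 4)"
        unfolding verts' by auto
      obtain e where "e \<in> pairs 4" "w \<in> set (P e)"
        using w(2) by (auto simp: linkage_graph_def verts_def)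
      then show "{u, w} \<in> edges ?G"
        using u[of e] by (auto simp: linkage_graph_def edges_def path_nbrs_def insert_commute)
    next
      fix a b assume "{a, b} \<in> edges (linkage_graph P' 4)"
      then obtain e where e: "e \<in> pairs 4" "{a, b} \<in> path_edges (P' e)"
        by (auto simp: linkage_graph_def edges_def)
      have "{a, b} \<in> path_edges (P e) \<or> a = u \<and> {w, b} \<in> path_edges (P e) \<or>
          b = u \<and> {w, a} \<in> path_edges (P e)"
      proof (cases "w \<in> set (P e)")
        case True
        then show ?thesis
          using path_edges_filter[OF True _ _ _ u[OF e(1) True]] ends[OF e(1)]
            linkage_ends(5)[OF P e(1)] e(2) unfolding P'_def by metis
      next
        case False
        then have "P' e = P e" by (auto simp: P'_def filter_id_conv)
        then show ?thesis using e by simp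
      qed
      then show "{a, b} \<in> edges ?G \<or> a = u \<and> {w, b} \<in> edges ?G \<or> b = u \<and> {w, a} \<in> edges ?G"
        using e(1) by (auto simp: linkage_graph_def edges_def)
    qed (fact w(2))
    then show ?thesis by blast
  qed
qed

section \<open>Minors from immersions\<close>

lemma immersion_imp_linkage:
  assumes "has_K_immersion G t"
  obtains \<phi> P where "linkage \<phi> P t" "\<phi> ` {..<t} \<subseteq> verts G"
    "verts (linkage_graph P t) \<subseteq> verts G" "edges (linkage_graph P t) \<subseteq> edges G"
    "\<And>e f. e \<in> pairs t \<Longrightarrow> f \<in> pairs t \<Longrightarrow> e \<noteq> f \<Longrightarrow> path_edges (P e) \<inter> path_edges (P f) = {}"
proof -
  obtain \<phi> and P :: "nat \<Rightarrow> nat \<Rightarrow> 'a list" where \<phi>: "inj_on \<phi> {..<t}" "\<phi> ` {..<t} \<subseteq> verts G"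
    and path_raw: "\<forall>i<t. \<forall>j<t. i < j \<longrightarrow> is_path G (P i j) (\<phi> i) (\<phi> j)"
    and dis_raw: "\<forall>i<t. \<forall>j<t. \<forall>k<t. \<forall>l<t. i < j \<and> k < l \<and> (i, j) \<noteq> (k, l) \<longrightarrow>
      path_edges (P i j) \<inter> path_edges (P k l) = {}"
    using assms unfolding has_K_immersion_def by (elim exE conjE) rule
  have path: "is_path G (P i j) (\<phi> i) (\<phi> j)" if "i < j" "j < t" for i j
    using path_raw that by simp
  have dis: "path_edges (P i j) \<inter> path_edges (P k l) = {}"
    if "i < j" "j < t" "k < l" "l < t" "(i, j) \<noteq> (k, l)" for i j k l
  proof -
    have "i < t" "k < t" using that by auto
    then show ?thesis using dis_raw[rule_format, of i j k l] that by simp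
  qed
  \<comment> \<open>\<open>Min\<close> and \<open>Max\<close> recover the ordered index pair from
    the unordered one.\<close>
  define Q where "Q e = P (Min e) (Max e)" for e
  have Q: "Q {i, j} = P i j" if "i < j" for i j
    using that by (simp add: Q_def min_def max_def)
  have path_Q: "Q e \<noteq> [] \<and> distinct (Q e) \<and> {hd (Q e), last (Q e)} = \<phi> ` e \<and>
      set (Q e) \<subseteq> verts G \<and> path_edges (Q e) \<subseteq> edges G" if e: "e \<in> pairs t" for e
  proof -
    obtain i j where "i < j" "j < t" "e = {i, j}" using e unfolding pairs_iff by blast
    then show ?thesis using path[of i j] Q[of i j] by (simp add: is_path_iff)
  qed
  show thesis
  proof (rule that[of \<phi> Q])
    show "linkage \<phi> Q t" unfolding linkage_def using \<phi>(1) path_Q by blast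
    show "verts (linkage_graph Q t) \<subseteq> verts G" "edges (linkage_graph Q t) \<subseteq> edges G"
      unfolding linkage_graph_def using path_Q
      by (simp_all add: verts_def edges_def UN_subset_iff)
    fix e f assume ef: "e \<in> pairs t" "f \<in> pairs t" "e \<noteq> f"
    obtain i j where ij: "i < j" "j < t" "e = {i, j}" using ef(1) pairs_iff by blast
    obtain k l where kl: "k < l" "l < t" "f = {k, l}" using ef(2) pairs_iff by blast
    have "(i, j) \<noteq> (k, l)" using ef(3) ij kl by auto
    then show "path_edges (Q e) \<inter> path_edges (Q f) = {}"
      using dis[OF ij(1,2) kl(1,2)] Q[OF ij(1)] Q[OF kl(1)] ij(3) kl(3) by simp
  qed (fact \<phi>(2))
qed

text \<open>Edge-disjoint paths have disjoint neighbourhoods at \<open>v\<close>, because a common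
  neighbour would give a common edge.\<close>

lemma linkage_degree_ge_sum:
  assumes dis: "\<And>e f. e \<in> pairs t \<Longrightarrow> f \<in> pairs t \<Longrightarrow> e \<noteq> f \<Longrightarrow> path_edges (P e) \<inter> path_edges (P f) = {}"
    and F: "F \<subseteq> pairs t" and E: "edges (linkage_graph P t) \<subseteq> E" "finite {x. {v, x} \<in> E}"
  shows "(\<Sum>e\<in>F. card (path_nbrs (P e) v)) \<le> card {x. {v, x} \<in> E}"
proof -
  have "finite F" using F finite_pairs finite_subset by blast
  have "path_nbrs (P e) v \<inter> path_nbrs (P f) v = {}" if "e \<in> F" "f \<in> F" "e \<noteq> f" for e f
    using dis[of e f] that F unfolding path_nbrs_def by blast
  then have "(\<Sum>e\<in>F. card (path_nbrs (P e) v)) = card (\<Union>e\<in>F. path_nbrs (P e) v)"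
    using \<open>finite F\<close> by (subst card_UN_disjoint) auto
  also have "\<dots> \<le> card {x. {v, x} \<in> E}"
  proof (rule card_mono[OF E(2)])
    have "path_nbrs (P e) v \<subseteq> {x. {v, x} \<in> edges (linkage_graph P t)}" if "e \<in> F" for e
      using that F unfolding linkage_graph_nbrs by blast
    then show "(\<Union>e\<in>F. path_nbrs (P e) v) \<subseteq> {x. {v, x} \<in> E}" using E(1) by blast
  qed
  finally show ?thesis .
qed

lemma card_pairs_at:
  assumes "k < t"
  shows "card {e \<in> pairs t. k \<in> e} = t - 1"
proof -
  have "{e \<in> pairs t. k \<in> e} = (\<lambda>j. {k, j}) ` ({..<t} - {k})"
  proof (intro set_eqI iffI)
    fix e assume "e \<in> {e \<in> pairs t. k \<in> e}"
    then obtain i j where "i < j" "j < t" "e = {i, j}" "k \<in> {i, j}" by (auto simp: pairs_iff)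
    then show "e \<in> (\<lambda>j. {k, j}) ` ({..<t} - {k})"
      by (cases "k = i") (auto simp: insert_commute)
  qed (use assms in \<open>auto simp: doubleton_in_pairs\<close>)
  moreover have "inj_on (\<lambda>j. {k, j}) ({..<t} - {k})"
    by (auto simp: inj_on_def doubleton_eq_iff)
  ultimately show ?thesis using assms by (simp add: card_image)
qed

lemma path_nbrs_branch_card:
  assumes P: "linkage \<phi> P t" and e: "e \<in> pairs t" "k \<in> e"
  shows "1 \<le> card (path_nbrs (P e) (\<phi> k))"
proof -
  have "\<phi> k \<in> set (P e)" using linkage_ends(4)[OF P e(1)] e(2) by blast
  then show ?thesis
    using path_nbrs_nonempty linkage_ends(3)[OF P e(1)] by (simp add: Suc_le_eq card_gt_0_iff)
qed

lemma path_nbrs_interior_card: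
  assumes P: "linkage \<phi> P t" and e: "e \<in> pairs t" "v \<in> set (P e)" "v \<notin> \<phi> ` e"
  shows "card (path_nbrs (P e) v) = 2"
proof -
  have "v \<noteq> hd (P e)" "v \<noteq> last (P e)" using linkage_ends[OF P e(1)] e(3) by auto
  then obtain a b where "a \<noteq> b" "path_nbrs (P e) v = {a, b}"
    using path_nbrs_interior[OF e(2) _ _ linkage_ends(5)[OF P e(1)]] by blast
  then show ?thesis by simp
qed

text \<open>Each of the \<open>t - 1\<close> paths that end at \<open>\<phi> k\<close> contributes a
  neighbour of its own.\<close>

lemma linkage_branch_degree:
  assumes P: "linkage \<phi> P t"
    and dis: "\<And>e f. e \<in> pairs t \<Longrightarrow> f \<in> pairs t \<Longrightarrow> e \<noteq> f \<Longrightarrow> path_edges (P e) \<inter> path_edges (P f) = {}"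
    and E: "edges (linkage_graph P t) \<subseteq> E" "finite {x. {\<phi> k, x} \<in> E}" and k: "k < t"
  shows "t - 1 \<le> card {x. {\<phi> k, x} \<in> E}"
proof -
  have "t - 1 = (\<Sum>e\<in>{e \<in> pairs t. k \<in> e}. 1)" using card_pairs_at[OF k] by simp
  also have "\<dots> \<le> (\<Sum>e\<in>{e \<in> pairs t. k \<in> e}. card (path_nbrs (P e) (\<phi> k)))"
    using path_nbrs_branch_card[OF P] by (intro sum_mono) auto
  also have "\<dots> \<le> card {x. {\<phi> k, x} \<in> E}"
    by (rule linkage_degree_ge_sum[OF dis _ E]) auto
  finally show ?thesis .
qed

lemma simple_graph_finite_nbrs:
  assumes "simple_graph G"
  shows "finite {x. {v, x} \<in> edges G}"
proof (rule finite_subset)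
  show "{x. {v, x} \<in> edges G} \<subseteq> verts G" using assms unfolding simple_graph_def by blast
qed (use assms in \<open>simp add: simple_graph_def\<close>)

lemma immersion_branch_degree:
  assumes G: "simple_graph G" and "has_K_immersion G t"
  obtains \<phi> where "inj_on \<phi> {..<t}" "\<phi> ` {..<t} \<subseteq> verts G"
    "\<And>k. k < t \<Longrightarrow> t - 1 \<le> card {x. {\<phi> k, x} \<in> edges G}"
proof (rule immersion_imp_linkage[OF assms(2)])
  fix \<phi> P
  assume "linkage \<phi> P t" "\<phi> ` {..<t} \<subseteq> verts G" "edges (linkage_graph P t) \<subseteq> edges G"
    and "\<And>e f. e \<in> pairs t \<Longrightarrow> f \<in> pairs t \<Longrightarrow> e \<noteq> f \<Longrightarrow> path_edges (P e) \<inter> path_edges (P f) = {}"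
  then show thesis
    using linkage_branch_degree[of \<phi> P t "edges G"] simple_graph_finite_nbrs[OF G] that[of \<phi>]
    by (simp add: linkage_def)
qed

section \<open>Minors from immersions for \<open>t = 2, 3, 4\<close>\<close>

lemma immersion_imp_K_model_2:
  assumes G: "simple_graph G" and "has_K_immersion G 2"
  shows "\<exists>B. K_model G 2 B"
proof -
  obtain \<phi> :: "nat \<Rightarrow> 'a" where "\<forall>k<2. 2 - 1 \<le> card {x. {\<phi> k, x} \<in> edges G}"
    by (rule immersion_branch_degree[OF assms]) auto
  from this[rule_format, of 0] have "card {x. {\<phi> 0, x} \<in> edges G} \<noteq> 0" by simp
  then have "{x. {\<phi> 0, x} \<in> edges G} \<noteq> {}" by (metis card.empty)
  then obtain x where x: "{\<phi> 0, x} \<in> edges G" by blast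
  have "card {\<phi> 0, x} = 2" "{\<phi> 0, x} \<subseteq> verts G"
    using G x unfolding simple_graph_def by blast+
  then have "K_model G 2 (\<lambda>i. {[\<phi> 0, x] ! i})"
    using x by (intro K_model_singletons) (auto simp: less_Suc_eq numeral_2_eq_2)
  then show ?thesis by blast
qed

text \<open>The union of the paths has minimum degree 2: a branch vertex is the end of two
  edge-disjoint paths, and any other vertex has two neighbours on one path.\<close>

lemma immersion_imp_K_model_3:
  assumes "has_K_immersion G 3"
  shows "\<exists>B. K_model G 3 B"
proof (rule immersion_imp_linkage[OF assms])
  fix \<phi> P
  assume P: "linkage \<phi> P 3" and sub: "verts (linkage_graph P 3) \<subseteq> verts G"
      "edges (linkage_graph P 3) \<subseteq> edges G"
    and dis: "\<And>e f. e \<in> pairs 3 \<Longrightarrow> f \<in> pairs 3 \<Longrightarrow> e \<noteq> f \<Longrightarrow> path_edges (P e) \<inter> path_edges (P f) = {}"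
  let ?H = "linkage_graph P 3"
  have fin: "finite (verts ?H)" by (simp add: linkage_graph_def verts_def)
  have nbrs: "{x \<in> verts ?H. {v, x} \<in> edges ?H} = {x. {v, x} \<in> edges ?H}" for v
    using linkage_graph_edges_card(2)[OF P] by blast
  have fin_nbrs: "finite {x. {v, x} \<in> edges ?H}" for v
    unfolding linkage_graph_nbrs by simp
  have "{0, 1} \<in> pairs 3" by (rule doubleton_in_pairs) auto
  then have ne: "verts ?H \<noteq> {}"
    using linkage_ends(6)[OF P] by (auto simp: linkage_graph_def verts_def)
  have loopless: "{v} \<notin> edges ?H" for v using linkage_graph_edges_card(1)[OF P, of "{v}"] by auto
  have deg: "2 \<le> card {x \<in> verts ?H. {v, x} \<in> edges ?H}" if v: "v \<in> verts ?H" for v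
  proof (cases "v \<in> \<phi> ` {..<3}")
    case True
    then show ?thesis
      using linkage_branch_degree[OF P dis order_refl fin_nbrs] unfolding nbrs by fastforce
  next
    case False
    obtain e where e: "e \<in> pairs 3" "v \<in> set (P e)"
      using v by (auto simp: linkage_graph_def verts_def)
    then have "v \<notin> \<phi> ` e" using False by (auto simp: pairs_def)
    then have "card (path_nbrs (P e) v) = 2" by (rule path_nbrs_interior_card[OF P e])
    moreover have "path_nbrs (P e) v \<subseteq> {x. {v, x} \<in> edges ?H}"
      unfolding linkage_graph_nbrs using e(1) by blast
    ultimately show ?thesis unfolding nbrs using card_mono[OF fin_nbrs] by metis
  qed
  have "\<exists>B. K_model (verts ?H, edges ?H) 3 B"
    by (rule min_degree_2_K_model[OF fin ne loopless deg])
  then obtain B where "K_model ?H 3 B" by (auto simp: verts_def edges_def)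
  then show ?thesis using K_model_mono[OF _ sub] by blast
qed

text \<open>The edges at a vertex are counted against the bound 4. A branch vertex spends three on
  its own paths and has no two left for a further path; any other vertex spends two on each path
  through it. These are the two assumptions of \<open>linkage_K4_model\<close>.\<close>

lemma immersion_imp_K_model_4:
  assumes G: "simple_graph G" and "has_K_immersion G 4"
    and deg: "\<And>v. v \<in> verts G \<Longrightarrow> card {x. {v, x} \<in> edges G} \<le> 4"
  shows "\<exists>B. K_model G 4 B"
proof (rule immersion_imp_linkage[OF assms(2)])
  fix \<phi> P
  assume P: "linkage \<phi> P 4" and sub: "verts (linkage_graph P 4) \<subseteq> verts G"
      "edges (linkage_graph P 4) \<subseteq> edges G"
    and dis: "\<And>e f. e \<in> pairs 4 \<Longrightarrow> f \<in> pairs 4 \<Longrightarrow> e \<noteq> f \<Longrightarrow> path_edges (P e) \<inter> path_edges (P f) = {}"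
  have sum: "(\<Sum>e\<in>F. card (path_nbrs (P e) v)) \<le> 4" if "F \<subseteq> pairs 4" "v \<in> verts G" for F v
    using linkage_degree_ge_sum[OF dis that(1) sub(2) simple_graph_finite_nbrs[OF G]] deg[OF that(2)]
    by (rule le_trans)
  have in_G: "v \<in> verts G" if "e \<in> pairs 4" "v \<in> set (P e)" for e v
    using that sub(1) by (auto simp: linkage_graph_def verts_def)
  have avoid: "k \<in> e" if e: "e \<in> pairs 4" and k: "k < 4" and on: "\<phi> k \<in> set (P e)" for e k
  proof (rule ccontr)
    assume "k \<notin> e"
    have "e \<subseteq> {..<4}" using e by (simp add: pairs_def)
    moreover have "inj_on \<phi> {..<4}" using P by (simp add: linkage_def)
    ultimately have "\<phi> k \<notin> \<phi> ` e" using \<open>k \<notin> e\<close> k by (auto dest: inj_onD)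
    then have "card (path_nbrs (P e) (\<phi> k)) = 2" by (rule path_nbrs_interior_card[OF P e on])
    moreover have "(\<Sum>f\<in>{f \<in> pairs 4. k \<in> f}. 1) \<le> (\<Sum>f\<in>{f \<in> pairs 4. k \<in> f}. card (path_nbrs (P f) (\<phi> k)))"
      using path_nbrs_branch_card[OF P] by (intro sum_mono) auto
    moreover have "(\<Sum>f\<in>{f \<in> pairs 4. k \<in> f}. 1) = (3 :: nat)" using card_pairs_at[OF k] by simp
    moreover have "(\<Sum>f\<in>insert e {f \<in> pairs 4. k \<in> f}. card (path_nbrs (P f) (\<phi> k))) \<le> 4"
      using e in_G[OF e on] by (intro sum) auto
    ultimately show False using \<open>k \<notin> e\<close> by simp
  qed
  have two: "card {e \<in> pairs 4. v \<in> set (P e)} \<le> 2" if v: "v \<notin> \<phi> ` {..<4}" for v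
  proof (cases "{e \<in> pairs 4. v \<in> set (P e)} = {}")
    case False
    then have "v \<in> verts G" using in_G by blast
    have "card (path_nbrs (P e) v) = 2" if "e \<in> pairs 4" "v \<in> set (P e)" for e
      using that v by (intro path_nbrs_interior_card[OF P]) (auto simp: pairs_def)
    then have "(\<Sum>e\<in>{e \<in> pairs 4. v \<in> set (P e)}. card (path_nbrs (P e) v)) =
        (\<Sum>e\<in>{e \<in> pairs 4. v \<in> set (P e)}. 2)" by (intro sum.cong) auto
    then show ?thesis using sum[of "{e \<in> pairs 4. v \<in> set (P e)}" v] \<open>v \<in> verts G\<close> by simp
  next
    case True
    show ?thesis unfolding True by simp
  qed
  obtain B where "K_model (linkage_graph P 4) 4 B"
    using linkage_K4_model[OF P avoid two] by blast
  then show ?thesis using K_model_mono[OF _ sub] by blast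
qed

text \<open>The edges of the root graph at a vertex \<open>h\<close> form a clique
  \<open>star h\<close> in \<open>G\<close>. If every star has at most three elements, an edge of
  the root graph meets at most two others at each end, which gives the degree bound 4.\<close>

lemma line_graph_immersion_imp_K_model_4:
  assumes G: "simple_graph G" "line_graph G" and imm: "has_K_immersion G 4"
  shows "\<exists>B. K_model G 4 B"
proof -
  obtain ends :: "'a \<Rightarrow> nat set" where ends: "\<And>v. v \<in> verts G \<Longrightarrow> card (ends v) = 2"
    and adj: "\<And>u v. u \<in> verts G \<Longrightarrow> v \<in> verts G \<Longrightarrow> u \<noteq> v \<Longrightarrow>
      {u, v} \<in> edges G \<longleftrightarrow> ends u \<inter> ends v \<noteq> {}"
    using G(2) unfolding line_graph_def by blast
  have fin: "finite (verts G)" using G(1) by (simp add: simple_graph_def)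
  define star where "star h = {v \<in> verts G. h \<in> ends v}" for h
  have fin_star: "finite (star h)" for h using fin by (simp add: star_def)
  show ?thesis
  proof (cases "\<exists>h. 4 \<le> card (star h)")
    case True
    then obtain h S where S: "S \<subseteq> star h" "card S = 4" by (meson obtain_subset_with_card_n)
    then have "finite S" using fin_star finite_subset by blast
    then obtain b :: "nat \<Rightarrow> 'a" where b: "bij_betw b {..<4} S"
      using ex_bij_betw_nat_finite[of S] S(2) by (auto simp: atLeast0LessThan)
    have "K_model G 4 (\<lambda>i. {b i})"
    proof (rule K_model_singletons)
      have in_star: "b i \<in> star h" if "i < 4" for i using b S that by (auto simp: bij_betw_def)
      then show "b i \<in> verts G" if "i < 4" for i using that by (simp add: star_def)
      fix i j :: nat assume ij: "i < j" "j < 4"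
      then show "b i \<noteq> b j" using b by (auto simp: bij_betw_def inj_on_def)
      then show "{b i, b j} \<in> edges G"
        using adj in_star[of i] in_star[of j] ij by (auto simp: star_def)
    qed
    then show ?thesis by blast
  next
    case False
    have "card {x. {v, x} \<in> edges G} \<le> 4" if v: "v \<in> verts G" for v
    proof -
      obtain h1 h2 where h: "ends v = {h1, h2}" using ends[OF v] by (auto simp: card_2_iff)
      have "{x. {v, x} \<in> edges G} \<subseteq> (star h1 - {v}) \<union> (star h2 - {v})"
      proof
        fix x assume "x \<in> {x. {v, x} \<in> edges G}"
        then have vx: "{v, x} \<in> edges G" by simp
        then have "card {v, x} = 2" "{v, x} \<subseteq> verts G"
          using G(1) unfolding simple_graph_def by blast+
        then have "v \<noteq> x" "x \<in> verts G" by auto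
        then show "x \<in> (star h1 - {v}) \<union> (star h2 - {v})"
          using adj[OF v, of x] vx h by (auto simp: star_def)
      qed
      then have "card {x. {v, x} \<in> edges G} \<le> card ((star h1 - {v}) \<union> (star h2 - {v}))"
        using fin_star by (intro card_mono) auto
      also have "\<dots> \<le> card (star h1 - {v}) + card (star h2 - {v})" by (rule card_Un_le)
      also have "\<dots> \<le> 2 + 2"
      proof (rule add_mono)
        have "card (star h - {v}) \<le> 2" if "v \<in> star h" for h
        proof -
          have "card (star h) < 4" using False by (simp add: not_le)
          then show ?thesis using that by (simp add: card_Diff_singleton)
        qed
        then show "card (star h1 - {v}) \<le> 2" "card (star h2 - {v}) \<le> 2"
          using v h by (auto simp: star_def)
      qed
      finally show ?thesis by simp
    qed
    then show ?thesis by (rule immersion_imp_K_model_4[OF G(1) imm])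
  qed
qed

lemma line_graph_immersion_iff_minor:
  assumes G: "simple_graph G" "line_graph G" and t: "0 < t" "t \<le> 4"
  shows "has_K_immersion G t \<longleftrightarrow> has_K_minor G t"
proof
  assume "has_K_minor G t"
  then show "has_K_immersion G t"
    using has_K_minor_iff_K_model[OF G(1)] K_model_imp_immersion[OF G(1) _ t(2)] by blast
next
  assume imm: "has_K_immersion G t"
  consider "t = 1" | "t = 2" | "t = 3" | "t = 4" using t by linarith
  then have "\<exists>B. K_model G t B"
  proof cases
    case 1
    then obtain \<phi> :: "nat \<Rightarrow> 'a" where "\<phi> ` {..<1} \<subseteq> verts G" using imm by (auto simp: has_K_immersion_def)
    then have "K_model G 1 (\<lambda>i. {\<phi> i})" by (intro K_model_singletons) auto
    then show ?thesis using 1 by blast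
  next
    case 2
    then show ?thesis using immersion_imp_K_model_2 G imm by blast
  next
    case 3
    then show ?thesis using immersion_imp_K_model_3 imm by blast
  next
    case 4
    then show ?thesis using line_graph_immersion_imp_K_model_4 G imm by blast
  qed
  then show "has_K_minor G t" using has_K_minor_iff_K_model[OF G(1)] by blast
qed

section \<open>Immersions and minors separated\<close>

text \<open>The line graph of the multigraph with edge set \<open>V\<close> and incidences
  \<open>ends\<close>; equal values of \<open>ends\<close> stand for parallel edges.\<close>

definition intersection_graph :: "'a set \<Rightarrow> ('a \<Rightarrow> nat set) \<Rightarrow> 'a graph" where
  "intersection_graph V ends =
     (V, {{u, v} | u v. u \<in> V \<and> v \<in> V \<and> u \<noteq> v \<and> ends u \<inter> ends v \<noteq> {}})"

lemma verts_intersection_graph [simp]: "verts (intersection_graph V ends) = V"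
  by (simp add: intersection_graph_def verts_def)

lemma intersection_graph_edge_iff [simp]:
  "{u, v} \<in> edges (intersection_graph V ends) \<longleftrightarrow>
     u \<in> V \<and> v \<in> V \<and> u \<noteq> v \<and> ends u \<inter> ends v \<noteq> {}"
  by (auto simp: intersection_graph_def edges_def doubleton_eq_iff)

lemma simple_graph_intersection_graph: "finite V \<Longrightarrow> simple_graph (intersection_graph V ends)"
  by (auto simp: simple_graph_def intersection_graph_def verts_def edges_def)

lemma line_graph_intersection_graph:
  "(\<And>v. v \<in> V \<Longrightarrow> card (ends v) = 2) \<Longrightarrow> line_graph (intersection_graph V ends)"
  unfolding line_graph_def by (intro exI[of _ ends]) simp

text \<open>The ends of a non-edge cannot both form singleton branch sets. So at least three vertices are
  unused or lie in larger branch sets, which is too many for \<open>t\<close> branch sets on \<open>t + 1\<close> vertices.\<close>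

lemma no_K_model_three_nonedges:
  assumes V: "finite (verts G)" "card (verts G) = Suc t"
    and xy: "\<And>i. i < 3 \<Longrightarrow> {x i, y i} \<subseteq> verts G \<and> {x i, y i} \<notin> edges G \<and> x i \<noteq> y i"
    and dis: "\<And>i j. i < 3 \<Longrightarrow> j < (3::nat) \<Longrightarrow> i \<noteq> j \<Longrightarrow> {x i, y i} \<inter> {x j, y j} = {}"
  shows "\<not> K_model G t B"
proof
  assume B: "K_model G t B"
  define I where "I = {i \<in> {..<t}. card (B i) = 1}"
  define S where "S = (\<Union>i\<in>I. B i)"
  have B_sub: "B i \<subseteq> verts G" and B_ne: "B i \<noteq> {}" if "i < t" for i
    using B that by (auto simp: K_model_def connected_in_def)
  have B_fin: "finite (B i)" if "i < t" for i using B_sub[OF that] V finite_subset by blast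
  have B_dis: "B i \<inter> B j = {}" if "i < t" "j < t" "i \<noteq> j" for i j
    using B that by (auto simp: K_model_def)
  have card_S: "card S = card I"
  proof -
    have "card S = (\<Sum>i\<in>I. card (B i))"
      unfolding S_def using B_fin B_dis by (intro card_UN_disjoint) (auto simp: I_def)
    then show ?thesis by (simp add: I_def)
  qed
  \<comment> \<open>Branch sets that are not singletons have at least two vertices, and all fit into
    \<open>t + 1\<close> vertices; so at least \<open>t - 1\<close> of them are singletons.\<close>
  have "2 * t \<le> Suc t + card I"
  proof -
    have "(\<Sum>i<t. 2) \<le> (\<Sum>i<t. card (B i) + (if i \<in> I then 1 else 0))"
    proof (rule sum_mono)
      fix i assume "i \<in> {..<t}"
      then have "0 < card (B i)" using B_ne B_fin by (simp add: card_gt_0_iff)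
      then show "2 \<le> card (B i) + (if i \<in> I then 1 else 0)"
        using \<open>i \<in> {..<t}\<close> by (auto simp: I_def)
    qed
    also have "\<dots> = (\<Sum>i<t. card (B i)) + card I"
    proof -
      have "{..<t} \<inter> I = I" by (auto simp: I_def)
      then show ?thesis by (simp add: sum.distrib sum.If_cases)
    qed
    also have "(\<Sum>i<t. card (B i)) = card (\<Union>i<t. B i)"
      using B_fin B_dis by (intro card_UN_disjoint[symmetric]) auto
    also have "card (\<Union>i<t. B i) \<le> card (verts G)"
      using B_sub by (intro card_mono V(1)) blast
    also have "card (verts G) = Suc t" by (rule V(2))
    finally show ?thesis by simp
  qed
  \<comment> \<open>Each non-edge has an end outside the singleton branch sets, and these three ends
    are distinct. So at most \<open>t - 2\<close> branch sets are singletons.\<close>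
  moreover have "card I + 3 \<le> Suc t"
  proof -
    have "\<exists>z. z \<in> {x i, y i} \<and> z \<notin> S" if i: "i < 3" for i
    proof (rule ccontr)
      assume "\<nexists>z. z \<in> {x i, y i} \<and> z \<notin> S"
      then have "x i \<in> S" "y i \<in> S" by auto
      then obtain j k where jk: "j \<in> I" "k \<in> I" "x i \<in> B j" "y i \<in> B k" by (auto simp: S_def)
      then have single: "B j = {x i}" "B k = {y i}"
        by (auto simp: I_def card_1_singleton_iff)
      then have "j \<noteq> k" using xy[OF i] by auto
      then obtain a b where "a \<in> B j" "b \<in> B k" "{a, b} \<in> edges G"
        using K_model_obtain_edge[OF B, of j k] jk by (auto simp: I_def)
      then show False using single xy[OF i] by simp
    qed
    then have "\<forall>i\<in>{..<3}. \<exists>z. z \<in> {x i, y i} \<and> z \<notin> S" by blast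
    from bchoice[OF this] obtain z where z: "\<forall>i\<in>{..<3}. z i \<in> {x i, y i} \<and> z i \<notin> S" by blast
    have "inj_on z {..<3}"
    proof (rule inj_onI, rule ccontr)
      fix i j :: nat assume ij: "i \<in> {..<3}" "j \<in> {..<3}" "z i = z j" "i \<noteq> j"
      have "z i \<in> {x i, y i}" using z ij(1) by blast
      moreover have "z j \<in> {x j, y j}" using z ij(2) by blast
      ultimately have "z i \<in> {x i, y i} \<and> z i \<in> {x j, y j}" using ij(3) by simp
      then have "z i \<in> {x i, y i} \<inter> {x j, y j}" by (simp only: Int_iff)
      then show False using dis[of i j] ij by auto
    qed
    then have "card (z ` {..<3}) = 3" by (simp add: card_image)
    moreover have "card (S \<union> z ` {..<3}) = card S + card (z ` {..<3})"
      using z B_fin by (intro card_Un_disjoint) (auto simp: S_def I_def)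
    moreover have "card (S \<union> z ` {..<3}) \<le> card (verts G)"
    proof (rule card_mono[OF V(1)])
      have "S \<subseteq> verts G" unfolding S_def I_def using B_sub by blast
      moreover have "z i \<in> verts G" if "i < 3" for i using z xy[OF that] that by fastforce
      ultimately show "S \<union> z ` {..<3} \<subseteq> verts G" by blast
    qed
    ultimately show ?thesis using V(2) card_S by simp
  qed
  ultimately show False by linarith
qed

text \<open>The numbers from 5 on are the parallel edges, and \<open>0\<close> is the edge opposite to them.\<close>

definition K4_thick_ends :: "nat \<Rightarrow> nat set" where
  "K4_thick_ends v =
     (if v = 0 then {2, 3} else if v = 1 then {0, 2} else if v = 2 then {1, 3}
      else if v = 3 then {0, 3} else if v = 4 then {1, 2} else {0, 1})"

text \<open>All vertices except \<open>0\<close> are branch vertices, shifted by \<open>Suc\<close>.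
  Among them only \<open>{1, 2}\<close> and \<open>{3, 4}\<close> are non-adjacent, the pairs of
  opposite edges apart from the thick one; both are routed through \<open>0\<close>.\<close>

lemma K4_thick_immersion:
  assumes t: "5 \<le> t"
  shows "has_K_immersion (intersection_graph {..t} K4_thick_ends) t"
proof -
  let ?G = "intersection_graph {..t} K4_thick_ends"
  define P where "P i j = (if (i, j) = (0, 1) \<or> (i, j) = (2, 3) then [Suc i, 0, Suc j] else [Suc i, Suc j])"
    for i j :: nat
  have "is_path ?G (P i j) (Suc i) (Suc j)" if ij: "i < j" "j < t" for i j
  proof (cases "(i, j) = (0, 1) \<or> (i, j) = (2, 3)")
    case True
    then show ?thesis using t by (auto simp: P_def is_path_iff K4_thick_ends_def)
  next
    case False
    have "K4_thick_ends (Suc i) \<inter> K4_thick_ends (Suc j) \<noteq> {}"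
    proof -
      have "i \<in> {0, 1, 2, 3} \<or> 4 \<le> i" "j \<in> {0, 1, 2, 3} \<or> 4 \<le> j" by auto
      then show ?thesis using False ij(1) by (auto simp: K4_thick_ends_def)
    qed
    moreover have "P i j = [Suc i, Suc j]" using False unfolding P_def by (rule if_not_P)
    ultimately show ?thesis using ij by (simp add: is_path_iff)
  qed
  moreover have "path_edges (P i j) \<inter> path_edges (P k l) = {}"
    if "i < j" "k < l" "(i, j) \<noteq> (k, l)" for i j k l
    using that by (auto simp: P_def doubleton_eq_iff)
  ultimately show ?thesis
    unfolding has_K_immersion_def
    by (intro exI[of _ Suc] exI[of _ P]) auto
qed

lemma K4_thick_no_K_model:
  assumes t: "5 \<le> t"
  shows "\<not> K_model (intersection_graph {..t} K4_thick_ends) t B"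
proof (rule no_K_model_three_nonedges)
  let ?G = "intersection_graph {..t} K4_thick_ends"
  \<comment> \<open>The non-edges are the three pairs of opposite edges of \<open>K\<^sub>4\<close>.
    The vertex \<open>5\<close>, present since \<open>t \<ge> 5\<close>, stands for the thick
    edge.\<close>
  let ?x = "\<lambda>i :: nat. if i = 0 then 0 else if i = 1 then 1 else 3 :: nat"
  let ?y = "\<lambda>i :: nat. if i = 0 then 5 else if i = 1 then 2 else 4 :: nat"
  show "{?x i, ?y i} \<subseteq> verts ?G \<and> {?x i, ?y i} \<notin> edges ?G \<and> ?x i \<noteq> ?y i" for i
    using t by (simp add: K4_thick_ends_def)
  show "{?x i, ?y i} \<inter> {?x j, ?y j} = {}" if "i < 3" "j < 3" "i \<noteq> j" for i j
  proof -
    have "i \<in> {0, 1, 2}" "j \<in> {0, 1, 2}" using that by auto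
    then show ?thesis using that(3) by auto
  qed
qed simp_all

text \<open>The numbers below \<open>2 * t\<close> are the edges of the subdivided rim, a path on the vertices
  \<open>1, \<dots>, 2 * t + 1\<close>; the number \<open>2 * t + k\<close> is the spoke from the centre \<open>0\<close> to \<open>2 * k + 1\<close>.\<close>

definition fan_ends :: "nat \<Rightarrow> nat \<Rightarrow> nat set" where
  "fan_ends t v = (if v < 2 * t then {v + 1, v + 2} else {0, 2 * (v - 2 * t) + 1})"

text \<open>The whole rim is one branch set and every spoke is another. The spokes share the centre,
  and spoke \<open>2 * t + i - 1\<close> meets the rim edge \<open>2 * (i - 1)\<close> in the vertex
  \<open>2 * i - 1\<close>.\<close>

lemma fan_K_model:
  assumes t: "0 < t"
  shows "K_model (intersection_graph {..<3 * t - 1} (fan_ends t)) t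
    (\<lambda>i. if i = 0 then {..<2 * t} else {2 * t + i - 1})"
    (is "K_model ?G t ?B")
proof (rule K_modelI)
  fix i assume i: "i < t"
  then show "?B i \<subseteq> verts ?G" by auto
  have "path_edges [0..<2 * t] \<subseteq> edges ?G"
    unfolding path_edges_subset_iff using t by (auto simp: fan_ends_def)
  then have "connected_in (edges ?G) ((!) [0..<2 * t] ` {0..<2 * t})"
    using t by (intro connected_in_segment) auto
  moreover have "(!) [0..<2 * t] ` {0..<2 * t} = {..<2 * t}" by (auto simp: image_iff)
  ultimately show "connected_in (edges ?G) (?B i)" by simp
next
  fix i j assume ij: "i < j" "j < t"
  then show "?B i \<inter> ?B j = {}" by auto
  show "\<exists>x\<in>?B i. \<exists>y\<in>?B j. {x, y} \<in> edges ?G"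
  proof (cases "i = 0")
    case True
    have "{2 * (j - 1), 2 * t + j - 1} \<in> edges ?G"
      using ij by (auto simp: fan_ends_def)
    moreover have "2 * (j - 1) \<in> ?B i" "2 * t + j - 1 \<in> ?B j" using True ij by auto
    ultimately show ?thesis by blast
  next
    case False
    then show ?thesis using ij by (auto simp: fan_ends_def)
  qed
qed

text \<open>A rim edge meets at most two rim edges. Spokes end only at odd rim vertices, so at most
  one end of a rim edge carries a spoke; this is the purpose of the subdivision. For
  \<open>v = 0\<close> the truncated \<open>v - 1\<close> is \<open>v\<close> itself, which is
  harmless in an upper bound.\<close>

lemma fan_rim_degree:
  assumes "v < 2 * t"
  shows "card {x. {v, x} \<in> edges (intersection_graph {..<3 * t - 1} (fan_ends t))} \<le> 3"
proof -
  have "{x. {v, x} \<in> edges (intersection_graph {..<3 * t - 1} (fan_ends t))} \<subseteq>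
      {v - 1, v + 1, 2 * t + (v + 1) div 2}"
    using assms by (auto simp: fan_ends_def split: if_splits)
  then have "card {x. {v, x} \<in> edges (intersection_graph {..<3 * t - 1} (fan_ends t))} \<le>
      card {v - 1, v + 1, 2 * t + (v + 1) div 2}"
    by (rule card_mono[rotated]) simp
  also have "\<dots> \<le> 3" by (simp add: card_insert_if)
  finally show ?thesis .
qed

text \<open>A branch vertex needs degree at least \<open>t - 1 \<ge> 4\<close>, which rules out the
  rim edges, and there are only \<open>t - 1\<close> spokes for \<open>t\<close> branch
  vertices.\<close>

lemma fan_no_immersion:
  assumes t: "5 \<le> t"
  shows "\<not> has_K_immersion (intersection_graph {..<3 * t - 1} (fan_ends t)) t"
proof
  let ?G = "intersection_graph {..<3 * t - 1} (fan_ends t)"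
  assume imm: "has_K_immersion ?G t"
  have "simple_graph ?G" by (rule simple_graph_intersection_graph) simp
  then show False
  proof (rule immersion_branch_degree[OF _ imm])
    fix \<phi> assume \<phi>: "inj_on \<phi> {..<t}" "\<phi> ` {..<t} \<subseteq> verts ?G"
      and deg: "\<And>k. k < t \<Longrightarrow> t - 1 \<le> card {x. {\<phi> k, x} \<in> edges ?G}"
    have "\<not> \<phi> ` {..<t} \<subseteq> {2 * t..<3 * t - 1}"
    proof
      assume "\<phi> ` {..<t} \<subseteq> {2 * t..<3 * t - 1}"
      then have "card (\<phi> ` {..<t}) \<le> card {2 * t..<3 * t - 1}" by (intro card_mono) auto
      then show False using \<phi>(1) t by (simp add: card_image)
    qed
    then obtain k where k: "k < t" "\<phi> k \<notin> {2 * t..<3 * t - 1}" by blast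
    then have "\<phi> k < 2 * t" using \<phi>(2) by fastforce
    then show False using fan_rim_degree[of "\<phi> k" t] deg[OF k(1)] t by simp
  qed
qed

theorem theorem1p4:
  shows "(\<forall>(G :: 'a graph) (t :: nat). simple_graph G \<and> line_graph G \<and> 0 < t \<and> t \<le> 4 \<longrightarrow>
            (has_K_immersion G t \<longleftrightarrow> has_K_minor G t)) \<and>
         (\<forall>t :: nat. t \<ge> 5 \<longrightarrow>
            (\<exists>G :: nat graph. simple_graph G \<and> line_graph G \<and>
               has_K_immersion G t \<and> \<not> has_K_minor G t) \<and>
            (\<exists>G :: nat graph. simple_graph G \<and> line_graph G \<and>
               has_K_minor G t \<and> \<not> has_K_immersion G t))"
proof (intro conjI allI impI)
  fix G :: "'a graph" and t :: nat
  assume "simple_graph G \<and> line_graph G \<and> 0 < t \<and> t \<le> 4"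
  then show "has_K_immersion G t \<longleftrightarrow> has_K_minor G t"
    using line_graph_immersion_iff_minor by blast
next
  fix t :: nat assume t: "5 \<le> t"
  let ?G = "intersection_graph {..t} K4_thick_ends"
  have "simple_graph ?G" by (rule simple_graph_intersection_graph) simp
  moreover have "line_graph ?G"
    by (rule line_graph_intersection_graph) (simp add: K4_thick_ends_def)
  ultimately show "\<exists>G :: nat graph. simple_graph G \<and> line_graph G \<and>
      has_K_immersion G t \<and> \<not> has_K_minor G t"
    using K4_thick_immersion[OF t] K4_thick_no_K_model[OF t] has_K_minor_iff_K_model[of ?G t]
    by (intro exI[of _ ?G]) simp
next
  fix t :: nat assume t: "5 \<le> t"
  let ?G = "intersection_graph {..<3 * t - 1} (fan_ends t)"
  have "simple_graph ?G" by (rule simple_graph_intersection_graph) simp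
  moreover have "line_graph ?G"
    by (rule line_graph_intersection_graph) (simp add: fan_ends_def)
  ultimately show "\<exists>G :: nat graph. simple_graph G \<and> line_graph G \<and>
      has_K_minor G t \<and> \<not> has_K_immersion G t"
    using fan_K_model[of t] fan_no_immersion[OF t] t has_K_minor_iff_K_model[of ?G t]
    by (intro exI[of _ ?G]) auto
qed

end
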